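(* For every integer $d \ge 4$, \[ \frac{1}{d-2}\sqrt{\frac{(d-1)(d^2-2)}{2}} \;\le\; \mathfrak{S}(d) \;\le\; d+2, \] where $\mathfrak S(d) = \max\{\alpha_1,\alpha_2,\dots,\alpha_{e_d-1}\}$ and $(\alpha_1,\dots,\alpha_{e_d-1})$ is the saturation sequence of $d$.
   Context: The base field is $\mathbf Q$. For binary forms $A,B$ in $x_1,x_2$ of orders $p,q$ (with coefficients in any commutative $\mathbf Q$-algebra), the $r$-th transvectant is \[ (A,B)_r = \frac{(p-r)!\,(q-r)!}{p!\,q!}\sum_{i=0}^r (-1)^i\binom{r}{i}\frac{\partial^r A}{\partial x_1^{r-i}\partial x_2^i}\,\frac{\partial^r B}{\partial x_1^i\partial x_2^{r-i}} \] for $0\le r\le \min(p,q)$; it has order $p+q-2r$ in $x_1,x_2$. Let $R=\mathbf Q[a_0,\dots,a_d]$ with its standard grading, and let $\mathbb F=\sum_{i=0}^d\binom{d}{i}a_i x_1^{d-i}x_2^i$ be the generic binary form of order $d$. Let $e_d=\lfloor d/2\rfloor$ and, for $1\le q\le e_d$, let $\mathbb H_{2q}=(\mathbb F,\mathbb F)_{2q}$, a form of order $2d-4q$ in $x_1,x_2$ whose coefficients lie in $R_2$. Let $J_{2q}\subseteq R$ be the ideal generated by all the coefficients (with respect to $x_1,x_2$) of $\mathbb H_2,\mathbb H_4,\dots,\mathbb H_{2q}$. Then $J_2\subseteq J_4\subseteq\dots\subseteq J_{2e_d}=I_C$, where $I_C$ is the homogeneous ideal of the rational normal curve of degree $d$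 in $\mathbf P^d$ (the ideal of $2\times 2$ minors of the $2\times d$ matrix with rows $a_0,\dots,a_{d-1}$ and $a_1,\dots,a_d$). It is known that the saturation of $J_2$ is $I_C$, so all the $J_{2q}$ agree in sufficiently high degrees. For $1\le q\le e_d-1$ define \[ \alpha_q=\min\{m : (J_{2q})_t=(J_{2q+2})_t \text{ for all } t\ge m\}, \] where the subscript $t$ denotes the degree-$t$ graded piece. The sequence $(\alpha_1,\dots,\alpha_{e_d-1})$ is called the saturation sequence of $d$. *)

theory Defs
  imports
    Complex_Main
    "HOL-Library.Poly_Mapping"
    "HOL-Computational_Algebra.Polynomial"
    "HOL-Algebra.Ideal"
begin

text \<open>Polynomials over the rationals in countably many variables \<open>a\<^sub>0, a\<^sub>1, \<dots>\<close>: a monomial is the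
  finitely supported function giving the exponent of each variable. The ring
  \<open>\<rat>[a\<^sub>0, \<dots>, a\<^sub>d]\<close> is the substructure \<open>coord_ring d\<close> of the polynomials in which only
  the variables of index at most \<open>d\<close> occur.\<close>

type_synonym mono = "nat \<Rightarrow>\<^sub>0 nat"
type_synonym apoly = "mono \<Rightarrow>\<^sub>0 rat"

definition const_poly :: "rat \<Rightarrow> apoly" where
  "const_poly c = Poly_Mapping.single 0 c"

definition avar :: "nat \<Rightarrow> apoly" where
  "avar i = Poly_Mapping.single (Poly_Mapping.single i 1) 1"

definition coord_ring :: "nat \<Rightarrow> apoly ring" where
  "coord_ring d = \<lparr>carrier = {f. \<forall>m \<in> Poly_Mapping.keys f. Poly_Mapping.keys m \<subseteq> {0..d}},
          mult = (*), one = 1, zero = 0, add = (+)\<rparr>"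

definition mono_degree :: "mono \<Rightarrow> nat" where
  "mono_degree m = (\<Sum>i \<in> Poly_Mapping.keys m. Poly_Mapping.lookup m i)"

definition graded_piece :: "apoly set \<Rightarrow> nat \<Rightarrow> apoly set" where
  "graded_piece J t = {f \<in> J. \<forall>m \<in> Poly_Mapping.keys f. mono_degree m = t}"

text \<open>Polynomials in \<open>x\<^sub>1, x\<^sub>2\<close> are represented as polynomials in \<open>x\<^sub>1\<close> whose coefficients are
  polynomials in \<open>x\<^sub>2\<close>; thus \<open>coeff (coeff A i) j\<close> is the coefficient of \<open>x\<^sub>1\<^sup>i x\<^sub>2\<^sup>j\<close> in \<open>A\<close>.\<close>

type_synonym bform = "apoly poly poly"

definition form_x1 :: bform where "form_x1 = [:0, 1:]"

definition form_x2 :: bform where "form_x2 = [:[:0, 1:]:]"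

definition scalar_form :: "apoly \<Rightarrow> bform" where "scalar_form c = [:[:c:]:]"

definition partial1 :: "bform \<Rightarrow> bform" where "partial1 A = pderiv A"

definition partial2 :: "bform \<Rightarrow> bform" where "partial2 A = map_poly pderiv A"

text \<open>The orders \<open>p\<close>, \<open>q\<close> of the forms are passed explicitly, because they cannot be recovered from
  a form that happens to vanish. The definition is meant for \<open>r \<le> min p q\<close>.\<close>

definition transvectant :: "nat \<Rightarrow> nat \<Rightarrow> nat \<Rightarrow> bform \<Rightarrow> bform \<Rightarrow> bform" where
  "transvectant p q r A B =
     scalar_form (const_poly (fact (p - r) * fact (q - r) / (fact p * fact q))) *
     (\<Sum>i = 0..r. (- 1) ^ i * of_nat (r choose i) *
        ((partial1 ^^ (r - i)) ((partial2 ^^ i) A)) * ((partial1 ^^ i) ((partial2 ^^ (r - i)) B)))"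

definition generic_form :: "nat \<Rightarrow> bform" where
  "generic_form d =
     (\<Sum>i = 0..d. of_nat (d choose i) * scalar_form (avar i) * form_x1 ^ (d - i) * form_x2 ^ i)"

text \<open>\<open>HH d k\<close> is the form \<open>(F, F)\<^sub>k\<close>; it is used for even \<open>k\<close> only.\<close>

definition HH :: "nat \<Rightarrow> nat \<Rightarrow> bform" where
  "HH d k = transvectant d d k (generic_form d) (generic_form d)"

definition bform_coeffs :: "bform \<Rightarrow> apoly set" where
  "bform_coeffs A = {coeff (coeff A i) j | i j. True}"

definition JJ :: "nat \<Rightarrow> nat \<Rightarrow> apoly set" where
  "JJ d k = Idl\<^bsub>coord_ring d\<^esub> (\<Union>q \<in> {q. 1 \<le> q \<and> 2 * q \<le> k}. bform_coeffs (HH d (2 * q)))"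

definition half_deg :: "nat \<Rightarrow> nat" where
  "half_deg d = d div 2"

definition alpha_seq :: "nat \<Rightarrow> nat \<Rightarrow> nat" where
  "alpha_seq d q =
     (LEAST m. \<forall>t \<ge> m. graded_piece (JJ d (2 * q)) t = graded_piece (JJ d (2 * q + 2)) t)"

definition max_alpha :: "nat \<Rightarrow> nat" where
  "max_alpha d = Max {alpha_seq d q | q. 1 \<le> q \<and> q \<le> half_deg d - 1}"

end

theory Submission
  imports Defs
begin

text \<open>
  Upper bound. Let \<open>J = J\<^sub>2\<close> and let \<open>E\<close> be the derivation \<open>a\<^sub>i \<mapsto> (d - i) a\<^bsub>i+1\<^esub>\<close>, which preserves \<open>J\<close>. It
  suffices that modulo \<open>J\<close> the monomials of degree \<open>t\<close> lie in the span of the \<open>E\<^sup>k(a\<^sub>0\<^sup>t)\<close>, because this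
  span meets the ideal of the curve only in 0. One descends on the exponent \<open>p\<close> of \<open>a\<^sub>0\<^sup>p m\<close>, with \<open>m\<close> a
  monomial of degree \<open>n = t - p\<close>. On the chart \<open>a\<^sub>0 \<noteq> 0\<close> the Hessian equations give \<open>a\<^sub>0\<^bsup>i-1\<^esup> a\<^sub>i \<equiv> a\<^sub>1\<^sup>i\<close>, hence \<open>E\<^sup>i(a\<^sub>0\<^bsup>p+1\<^esup>)\<close> is a multiple of
  \<open>a\<^sub>0\<^sup>p a\<^sub>i\<close> and the case \<open>p + 1\<close> settles all \<open>m\<close> containing some \<open>a\<^sub>i\<close> with \<open>i \<le> p + 1\<close>. The same
  descent from the other end of the curve, where squares of the remaining middle variables are
  rewritten by the Hessian equations until none is left, settles all \<open>m\<close> whose weight is not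
  within \<open>d - p - 2\<close> of the maximum \<open>nd\<close>. The remaining \<open>m\<close> of equal weight agree modulo \<open>J\<close>, and
  \<open>E\<^sup>i(a\<^sub>0\<^sup>p) g \<equiv> (-1)\<^sup>i a\<^sub>0\<^sup>p E\<^sup>i g\<close>: for \<open>p < n\<close> take \<open>i = dp + 1\<close>, which kills \<open>a\<^sub>0\<^sup>p\<close>; otherwise compare
  \<open>i = p - 1\<close> with \<open>i = p\<close>, where the signs disagree.

  Lower bound. In degree \<open>t\<close> the ideal of the curve has codimension \<open>dt + 1\<close>, while the \<open>2d - 3\<close>
  coefficients of the Hessian generate a space of dimension at most \<open>(2d - 3)\<close> times the number of
  monomials of degree \<open>t - 2\<close>.
\<close>

section \<open>Combinations of monomials and the Hessian ideal\<close>

lemma const_poly_zero [simp]: "const_poly 0 = 0"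
  and const_poly_one [simp]: "const_poly 1 = 1"
  and const_poly_add: "const_poly (x + y) = const_poly x + const_poly y"
  and const_poly_mult: "const_poly (x * y) = const_poly x * const_poly y"
  and const_poly_of_nat [simp]: "const_poly (of_nat n) = of_nat n"
  by (simp_all add: const_poly_def single_add mult_single)

lemma const_poly_uminus: "const_poly (- x) = - const_poly x"
  by (simp add: const_poly_def single_uminus)

lemma const_poly_diff: "const_poly (x - y) = const_poly x - const_poly y"
  by (simp add: const_poly_def single_diff)

text \<open>Ideals are treated throughout as rational subspaces, so that spans, minimality of spans
  and the bound on independent sets apply to them.\<close>

global_interpretation apoly: vector_space "\<lambda>c f. const_poly c * f"
  by unfold_locales (simp_all add: const_poly_add const_poly_mult algebra_simps)

lemma subspace_of_nat_cancel:
  assumes "apoly.subspace V" "of_nat n * f \<in> V" "n > 0"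
  shows "f \<in> V"
proof -
  have "const_poly (1 / of_nat n) * (of_nat n * f) \<in> V"
    using assms apoly.subspace_scale by blast
  moreover have "const_poly (1 / of_nat n) * (of_nat n * f) = const_poly (1 / of_nat n * of_nat n) * f"
    by (simp only: const_poly_mult const_poly_of_nat mult.assoc)
  ultimately show ?thesis using assms(3) by simp
qed

lemma subspace_scale_cancel:
  assumes "apoly.subspace V" "const_poly c * f \<in> V" "c \<noteq> 0"
  shows "f \<in> V"
proof -
  have "const_poly (1 / c) * (const_poly c * f) \<in> V"
    using assms apoly.subspace_scale by blast
  moreover have "const_poly (1 / c) * (const_poly c * f) = const_poly (1 / c * c) * f"
    by (simp only: const_poly_mult mult.assoc)
  ultimately show ?thesis using assms(3) by simp
qed

section \<open>Monomials as lists of indices, sorted by degree and weight\<close>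

definition mon :: "(nat \<Rightarrow> apoly) \<Rightarrow> nat list \<Rightarrow> apoly" where
  "mon a xs = prod_list (map a xs)"

lemma mon_simps [simp]: "mon a [] = 1" "mon a (x # xs) = a x * mon a xs"
  and mon_append: "mon a (xs @ ys) = mon a xs * mon a ys"
  by (simp_all add: mon_def)

lemma mon_remove1: "x \<in> set xs \<Longrightarrow> mon a xs = a x * mon a (remove1 x xs)"
  by (induction xs) (auto simp: mult.left_commute)

lemma sum_list_remove1: "x \<in> set xs \<Longrightarrow> sum_list xs = x + sum_list (remove1 x xs)" for x :: nat
  by (induction xs) auto

lemma sum_list_le: "set xs \<subseteq> {..d} \<Longrightarrow> sum_list xs \<le> d * length xs" for d :: nat
  by (induction xs) auto

lemma ex_list_of_weight:
  "v \<le> d * r \<Longrightarrow> \<exists>xs. set xs \<subseteq> {..d} \<and> length xs = r \<and> sum_list xs = v" for d :: nat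
proof (induction r arbitrary: v)
  case (Suc r)
  then have "v - min v d \<le> d * r" by (auto simp: min_def)
  then obtain xs where "set xs \<subseteq> {..d}" "length xs = r" "sum_list xs = v - min v d"
    using Suc.IH by blast
  then have "set (min v d # xs) \<subseteq> {..d}" "length (min v d # xs) = Suc r" "sum_list (min v d # xs) = v"
    by auto
  then show ?case by blast
qed simp

text \<open>\<open>comb a d r v f s\<close>: the element \<open>f\<close> is a linear combination of monomials of degree \<open>r\<close> and
  weight \<open>v\<close> in \<open>a 0, \<dots>, a d\<close>, and \<open>s\<close> is the sum of the coefficients.\<close>

inductive comb :: "(nat \<Rightarrow> apoly) \<Rightarrow> nat \<Rightarrow> nat \<Rightarrow> nat \<Rightarrow> apoly \<Rightarrow> rat \<Rightarrow> bool" for a d r v where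
  zero: "comb a d r v 0 0"
| step: "set xs \<subseteq> {..d} \<Longrightarrow> length xs = r \<Longrightarrow> sum_list xs = v \<Longrightarrow> comb a d r v f s
    \<Longrightarrow> comb a d r v (const_poly c * mon a xs + f) (c + s)"

lemma comb_mon: "set xs \<subseteq> {..d} \<Longrightarrow> length xs = r \<Longrightarrow> sum_list xs = v \<Longrightarrow> comb a d r v (mon a xs) 1"
  using comb.step[OF _ _ _ comb.zero, of xs d r v a 1] by simp

lemma comb_add: "comb a d r v f s \<Longrightarrow> comb a d r v g t \<Longrightarrow> comb a d r v (f + g) (s + t)"
proof (induction rule: comb.induct)
  case (step xs f s c)
  show ?case unfolding add.assoc by (rule comb.step[OF step(1-3) step.IH[OF step.prems]])
qed simp

lemma comb_scale: "comb a d r v f s \<Longrightarrow> comb a d r v (const_poly c * f) (c * s)"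
proof (induction rule: comb.induct)
  case zero
  then show ?case using comb.zero by simp
next
  case (step xs f s e)
  have "comb a d r v (const_poly (c * e) * mon a xs + const_poly c * f) (c * e + c * s)"
    by (rule comb.step[OF step(1-3) step.IH])
  then show ?case by (simp only: const_poly_mult distrib_left mult.assoc)
qed

lemma comb_scale_of_nat: "comb a d r v f s \<Longrightarrow> comb a d r v (of_nat n * f) (of_nat n * s)"
  using comb_scale[of a d r v f s "of_nat n"] by simp

lemma comb_mult:
  assumes "comb a d r v f s" "comb a d r' v' g t"
  shows "comb a d (r + r') (v + v') (f * g) (s * t)"
  using assms(1)
proof (induction rule: comb.induct)
  case zero
  then show ?case using comb.zero by simp
next
  case (step xs f s c)
  note xs = step.hyps(1-3)
  have "comb a d (r + r') (v + v') (mon a xs * g) t"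
    using assms(2)
  proof (induction rule: comb.induct)
    case zero
    then show ?case using comb.zero by simp
  next
    case (step ys g t e)
    have "comb a d (r + r') (v + v') (const_poly e * mon a (xs @ ys) + mon a xs * g) (e + t)"
      by (rule comb.step[OF _ _ _ step.IH]) (use step.hyps xs in auto)
    then show ?case by (simp add: mon_append algebra_simps)
  qed
  from comb_add[OF comb_scale[OF this, of c] step.IH]
  show ?case by (simp add: algebra_simps)
qed

lemma comb_var: "x \<le> d \<Longrightarrow> comb a d 1 x (a x) 1"
  using comb_mon[of "[x]" d 1 x a] by simp

lemma comb_one: "comb a d 0 0 1 1"
  using comb_mon[of "[]" d 0 0 a] by simp

lemma comb_pow: "x \<le> d \<Longrightarrow> comb a d r (x * r) (a x ^ r) 1"
proof (induction r)
  case 0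
  then show ?case using comb_one by simp
next
  case (Suc r)
  from comb_mult[OF comb_var[OF Suc.prems] Suc.IH[OF Suc.prems]] show ?case by simp
qed

lemma comb_in_subspace:
  assumes "comb a d r v f s" "apoly.subspace V"
    and "\<And>xs. set xs \<subseteq> {..d} \<Longrightarrow> length xs = r \<Longrightarrow> sum_list xs = v \<Longrightarrow> mon a xs \<in> V"
  shows "f \<in> V"
  using assms(1)
proof (induction rule: comb.induct)
  case zero
  then show ?case using assms by (intro apoly.subspace_0)
next
  case (step xs f s c)
  then show ?case using assms apoly.subspace_add apoly.subspace_scale by blast
qed

lemma comb_degenerate: "comb a d r v f s \<Longrightarrow> v > d * r \<Longrightarrow> f = 0"
proof (induction rule: comb.induct)
  case (step xs f s c)
  then show ?case using sum_list_le[of xs d] by simp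
qed simp

text \<open>Reading the curve from its other end replaces each index i by d - i, which exchanges low
  and high weights.\<close>

lemma comb_reverse:
  assumes "comb a d r v f s" "v \<le> d * r"
  shows "comb (\<lambda>i. a (d - i)) d r (d * r - v) f s"
  using assms(1)
proof (induction rule: comb.induct)
  case zero
  then show ?case by (rule comb.zero)
next
  case (step xs f s c)
  have *: "sum_list (map (\<lambda>i. d - i) xs) = d * length xs - sum_list xs \<and> mon (\<lambda>i. a (d - i)) (map (\<lambda>i. d - i) xs) = mon a xs"
    if "set xs \<subseteq> {..d}" for xs using that
  proof (induction xs)
    case (Cons x xs)
    then have "sum_list xs \<le> d * length xs" by (intro sum_list_le) auto
    with Cons show ?case by auto
  qed simp
  have "comb (\<lambda>i. a (d - i)) d r (d * r - v)
      (const_poly c * mon (\<lambda>i. a (d - i)) (map (\<lambda>i. d - i) xs) + f) (c + s)"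
    by (rule comb.step[OF _ _ _ step.IH]) (use step.hyps * in auto)
  then show ?case using * step by simp
qed

section \<open>The Hessian coefficients and congruences modulo them\<close>

text \<open>The coefficients of the Hessian \<open>(F, F)\<^sub>2\<close>, up to the factor 2.\<close>

definition hess_gen :: "(nat \<Rightarrow> apoly) \<Rightarrow> nat \<Rightarrow> nat \<Rightarrow> apoly" where
  "hess_gen a d n = (\<Sum>k\<le>n. of_nat ((d - 2 choose k) * (d - 2 choose (n - k))) *
     (a k * a (n - k + 2) - a (k + 1) * a (n - k + 1)))"

text \<open>Variables, ideal and derivation stay abstract because the results are applied twice with
  the same \<open>J\<close>: to \<open>avar\<close> with the raising operator, and to the reversed
  variables \<open>avar (d - i)\<close> with the lowering operator.\<close>

locale hess_ideal =
  fixes d :: nat and a :: "nat \<Rightarrow> apoly" and J :: "apoly set" and E :: "apoly \<Rightarrow> apoly"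
  assumes d_ge_2: "d \<ge> 2"
    and J_subspace: "apoly.subspace J"
    and J_mult: "i \<le> d \<Longrightarrow> f \<in> J \<Longrightarrow> a i * f \<in> J"
    and J_gen: "hess_gen a d n \<in> J"
    and E_add: "E (f + g) = E f + E g"
    and E_scale: "E (const_poly c * f) = const_poly c * E f"
    and E_mult: "E (f * g) = E f * g + f * E g"
    and E_var: "i \<le> d \<Longrightarrow> E (a i) = of_nat (d - i) * a (Suc i)"
    and E_J: "f \<in> J \<Longrightarrow> E f \<in> J"
begin

lemma E_zero: "E 0 = 0"
  using E_add[of 0 0] by simp

lemma E_one: "E 1 = 0"
  using E_mult[of 1 1] by simp

text \<open>By the Leibniz rule each factor \<open>a x\<close> contributes a monomial with
  coefficient \<open>d - x\<close>, and these numbers add up to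
  \<open>d * length xs - sum_list xs\<close>.\<close>

lemma comb_E_mon:
  "set xs \<subseteq> {..d} \<Longrightarrow> comb a d (length xs) (Suc (sum_list xs)) (E (mon a xs)) (of_nat (d * length xs - sum_list xs))"
proof (induction xs)
  case Nil
  then show ?case using comb.zero by (simp add: E_one)
next
  case (Cons x xs)
  have le: "x \<le> d" "sum_list xs \<le> d * length xs" using Cons.prems sum_list_le by auto
  have 1: "comb a d (1 + length xs) (x + Suc (sum_list xs)) (a x * E (mon a xs))
     (1 * of_nat (d * length xs - sum_list xs))"
    using Cons by (intro comb_mult comb_var Cons.IH) auto
  have 2: "comb a d (1 + length xs) (x + Suc (sum_list xs)) (E (a x) * mon a xs) (of_nat (d - x))"
  proof (cases "x = d")
    case True
    then show ?thesis using comb.zero by (simp add: E_var)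
  next
    case False
    with le have "comb a d (1 + length xs) (Suc x + sum_list xs) (a (Suc x) * mon a xs) (1 * 1)"
      using Cons by (intro comb_mult comb_var comb_mon) auto
    from comb_scale_of_nat[OF this, of "d - x"] show ?thesis using le by (simp add: E_var algebra_simps)
  qed
  have "of_nat (d * length (x # xs) - sum_list (x # xs)) = of_nat (d - x) + (of_nat (d * length xs - sum_list xs) :: rat)"
    using le by (simp add: of_nat_diff algebra_simps)
  with comb_add[OF 2 1] show ?case by (simp add: E_mult algebra_simps)
qed

lemma comb_E:
  assumes "comb a d r v f s"
  shows "comb a d r (Suc v) (E f) (of_nat (d * r - v) * s)"
  using assms
proof (induction rule: comb.induct)
  case zero
  then show ?case using comb.zero by (simp add: E_zero)
next
  case (step xs f s c)
  from comb_add[OF comb_scale[OF comb_E_mon[OF step(1)], of c]] step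
  show ?case by (simp add: E_add E_scale distrib_left distrib_right mult.commute)
qed

lemma comb_E_pow:
  assumes "comb a d r v f s"
  shows "comb a d r (v + i) ((E ^^ i) f) (of_nat (\<Prod>j<i. d * r - v - j) * s)"
proof (induction i)
  case 0
  then show ?case using assms by simp
next
  case (Suc i)
  from comb_E[OF Suc] show ?case by (simp add: ac_simps diff_diff_left)
qed

definition eqJ :: "apoly \<Rightarrow> apoly \<Rightarrow> bool" (infix "\<approx>" 50) where
  "f \<approx> g \<longleftrightarrow> f - g \<in> J"

lemma eqJ_refl [simp]: "f \<approx> f"
  using apoly.subspace_0[OF J_subspace] by (simp add: eqJ_def)

lemma eqJ_sym: "f \<approx> g \<Longrightarrow> g \<approx> f"
  using apoly.subspace_neg[OF J_subspace, of "f - g"] by (simp add: eqJ_def)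

lemma eqJ_trans [trans]: "f \<approx> g \<Longrightarrow> g \<approx> h \<Longrightarrow> f \<approx> h"
  using apoly.subspace_add[OF J_subspace, of "f - g" "g - h"] by (simp add: eqJ_def)

lemma eqJ_add: "f \<approx> g \<Longrightarrow> f' \<approx> g' \<Longrightarrow> f + f' \<approx> g + g'"
  using apoly.subspace_add[OF J_subspace, of "f - g" "f' - g'"] by (simp add: eqJ_def algebra_simps)

lemma eqJ_scale: "f \<approx> g \<Longrightarrow> const_poly c * f \<approx> const_poly c * g"
  using apoly.subspace_scale[OF J_subspace, of "f - g" c] by (simp add: eqJ_def algebra_simps)

lemma J_mult_pow: "i \<le> d \<Longrightarrow> f \<in> J \<Longrightarrow> a i ^ k * f \<in> J"
  by (induction k) (auto simp: mult.assoc intro: J_mult)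

lemma J_mult_mon: "set xs \<subseteq> {..d} \<Longrightarrow> f \<in> J \<Longrightarrow> mon a xs * f \<in> J"
  by (induction xs) (auto simp: mult.assoc intro: J_mult)

lemma eqJ_mult: "i \<le> d \<Longrightarrow> f \<approx> g \<Longrightarrow> a i * f \<approx> a i * g"
  using J_mult[of i "f - g"] by (simp add: eqJ_def algebra_simps)

lemma eqJ_mult_pow: "i \<le> d \<Longrightarrow> f \<approx> g \<Longrightarrow> a i ^ k * f \<approx> a i ^ k * g"
  using J_mult_pow[of i "f - g" k] by (simp add: eqJ_def algebra_simps)

lemma eqJ_mult_mon: "set xs \<subseteq> {..d} \<Longrightarrow> f \<approx> g \<Longrightarrow> mon a xs * f \<approx> mon a xs * g"
  using J_mult_mon[of xs "f - g"] by (simp add: eqJ_def algebra_simps)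

text \<open>On the chart \<open>a 0 \<noteq> 0\<close> the Hessian equations solve recursively for every \<open>a n\<close>.\<close>

lemma var_equiv: "n \<ge> 1 \<Longrightarrow> n \<le> d \<Longrightarrow> a 0 ^ (n - 1) * a n \<approx> a 1 ^ n"
proof (induction n rule: less_induct)
  case (less n)
  show ?case
  proof (cases "n = 1")
    case False
    define m where "m = n - 2"
    have n: "n = m + 2" using False less.prems by (simp add: m_def)
    define t where "t k = of_nat ((d - 2 choose k) * (d - 2 choose (m - k))) *
      (a 0 ^ m * (a k * a (m - k + 2) - a (k + 1) * a (m - k + 1)))" for k
    \<comment> \<open>The exponent m splits as (i - 1) + (j - 1), exactly what the induction
      hypotheses for \<open>a i\<close> and \<open>a j\<close> consume.\<close>
    have prod: "a 0 ^ m * (a i * a j) \<approx> a 1 ^ n" if "i \<ge> 1" "j \<ge> 1" "i + j = n" for i j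
    proof -
      have ij: "i < n" "j < n" "i \<le> d" "j \<le> d" "m = (i - 1) + (j - 1)" using that less.prems n by auto
      have "a 0 ^ m * (a i * a j) = a 0 ^ (i - 1) * (a i * (a 0 ^ (j - 1) * a j))"
        by (simp add: ij(5) power_add algebra_simps)
      also have "\<dots> \<approx> a 0 ^ (i - 1) * (a i * a 1 ^ j)"
        using less.IH[of j] ij that by (intro eqJ_mult_pow eqJ_mult) auto
      also have "a 0 ^ (i - 1) * (a i * a 1 ^ j) = a 1 ^ j * (a 0 ^ (i - 1) * a i)"
        by (simp add: algebra_simps)
      also have "\<dots> \<approx> a 1 ^ j * a 1 ^ i"
        using less.IH[of i] ij that d_ge_2 by (intro eqJ_mult_pow) auto
      also have "a 1 ^ j * a 1 ^ i = a 1 ^ n" using that by (simp add: power_add[symmetric] add.commute)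
      finally show ?thesis .
    qed
    \<comment> \<open>For k >= 1 both products in the k-th term have positive indices with sum n,
      hence become congruent to \<open>a 1 ^ n\<close>. Only the term k = 0 is left, and it contains
      \<open>a n\<close>.\<close>
    have t0: "t k \<in> J" if "k \<in> {..m} - {0}" for k
    proof -
      have "a 0 ^ m * (a k * a (m - k + 2)) \<approx> a 1 ^ n"
        using that n by (intro prod) auto
      moreover have "a 1 ^ n \<approx> a 0 ^ m * (a (k + 1) * a (m - k + 1))"
        using that n by (intro eqJ_sym[OF prod]) auto
      ultimately have "a 0 ^ m * (a k * a (m - k + 2)) \<approx> a 0 ^ m * (a (k + 1) * a (m - k + 1))"
        by (rule eqJ_trans)
      from apoly.subspace_scale[OF J_subspace this[unfolded eqJ_def], of "of_nat ((d - 2 choose k) * (d - 2 choose (m - k)))"]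
      show ?thesis unfolding t_def const_poly_of_nat by (simp only: right_diff_distrib)
    qed
    have "a 0 ^ m * hess_gen a d m = (\<Sum>k\<le>m. t k)"
      by (simp add: hess_gen_def t_def sum_distrib_left mult.left_commute)
    also have "\<dots> = t 0 + (\<Sum>k\<in>{..m} - {0}. t k)" by (subst sum.remove[of _ 0]) auto
    finally have "t 0 = a 0 ^ m * hess_gen a d m - (\<Sum>k\<in>{..m} - {0}. t k)" by simp
    also have "\<dots> \<in> J"
      by (intro apoly.subspace_diff[OF J_subspace] apoly.subspace_sum[OF J_subspace] J_mult_pow J_gen t0) auto
    finally have "of_nat (d - 2 choose m) * (a 0 ^ m * (a 0 * a n - a 1 * a (m + 1))) \<in> J"
      by (simp add: t_def n)
    then have "a 0 ^ m * (a 0 * a n - a 1 * a (m + 1)) \<in> J"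
      by (rule subspace_of_nat_cancel[OF J_subspace]) (use n less.prems in auto)
    then have "a 0 ^ (n - 1) * a n \<approx> a 0 ^ m * (a 1 * a (m + 1))"
      by (simp add: n eqJ_def algebra_simps)
    also have "\<dots> \<approx> a 1 ^ n" by (rule prod) (auto simp: n)
    finally show ?thesis .
  qed simp
qed

text \<open>Each factor \<open>a x\<close> uses up x - 1 factors \<open>a 0\<close>; the second
  hypothesis says that there are enough of them.\<close>

lemma mon_pos_equiv:
  "set xs \<subseteq> {1..d} \<Longrightarrow> k + length xs \<ge> sum_list xs
    \<Longrightarrow> a 0 ^ k * mon a xs \<approx> a 0 ^ (k + length xs - sum_list xs) * a 1 ^ sum_list xs"
proof (induction xs arbitrary: k)
  case (Cons x xs)
  have len: "length xs \<le> sum_list xs" using Cons.prems(1) by (induction xs) auto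
  define l where "l = k - (x - 1)"
  have x: "1 \<le> x" "x \<le> d" and k: "k = l + (x - 1)" using Cons.prems len by (auto simp: l_def)
  have "a 0 ^ k * mon a (x # xs) = mon a xs * (a 0 ^ l * (a 0 ^ (x - 1) * a x))"
    by (simp add: k power_add algebra_simps)
  also have "\<dots> \<approx> mon a xs * (a 0 ^ l * a 1 ^ x)"
    using Cons.prems x by (intro eqJ_mult_mon eqJ_mult_pow var_equiv) auto
  also have "mon a xs * (a 0 ^ l * a 1 ^ x) = a 1 ^ x * (a 0 ^ l * mon a xs)"
    by (simp add: algebra_simps)
  also have "\<dots> \<approx> a 1 ^ x * (a 0 ^ (l + length xs - sum_list xs) * a 1 ^ sum_list xs)"
    using Cons.prems x k by (intro eqJ_mult_pow Cons.IH) auto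
  also have "\<dots> = a 0 ^ (k + length (x # xs) - sum_list (x # xs)) * a 1 ^ sum_list (x # xs)"
    using x by (simp add: k power_add algebra_simps)
  finally show ?case .
qed simp

lemma mon_remove_zeros: "mon a xs = a 0 ^ (length xs - length (filter (\<lambda>x. x \<noteq> 0) xs)) * mon a (filter (\<lambda>x. x \<noteq> 0) xs)"
proof (induction xs)
  case (Cons x xs)
  have "length (filter (\<lambda>x. x \<noteq> 0) xs) \<le> length xs" by simp
  then show ?case using Cons by (auto simp: Suc_diff_le algebra_simps)
qed simp

lemma mon_equiv:
  assumes "set xs \<subseteq> {..d}" "sum_list xs \<le> length xs"
  shows "mon a xs \<approx> a 0 ^ (length xs - sum_list xs) * a 1 ^ sum_list xs"
proof -
  let ?ys = "filter (\<lambda>x. x \<noteq> 0) xs"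
  have *: "sum_list ?ys = sum_list xs" by (induction xs) auto
  have le: "length ?ys \<le> length xs" by simp
  have "a 0 ^ (length xs - length ?ys) * mon a ?ys
      \<approx> a 0 ^ (length xs - length ?ys + length ?ys - sum_list ?ys) * a 1 ^ sum_list ?ys"
    by (rule mon_pos_equiv) (use assms * le in auto)
  then show ?thesis unfolding mon_remove_zeros[symmetric] using le * by simp
qed

text \<open>As long as the weight does not exceed the degree, every monomial reduces to the same
  normal form \<open>a 0 ^ (r - v) * a 1 ^ v\<close>, so only the sum of the coefficients survives.
  This is why \<open>comb\<close> records that sum and nothing else about the coefficients.\<close>

lemma comb_equiv:
  assumes "comb a d r v f s" "comb a d r v g s" "v \<le> r"
  shows "f \<approx> g"
proof -
  have "f \<approx> const_poly s * (a 0 ^ (r - v) * a 1 ^ v)" if "comb a d r v f s" for f s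
    using that
  proof (induction rule: comb.induct)
    case (step xs f s c)
    from eqJ_add[OF eqJ_scale[OF mon_equiv[of xs]] step.IH, of c] step assms(3)
    show ?case by (simp add: const_poly_add algebra_simps)
  qed (simp)
  with assms show ?thesis using eqJ_sym eqJ_trans by blast
qed

text \<open>Both sides have degree p, weight x <= p and the same coefficient sum, so the power of
  \<open>E\<close> need not be expanded.\<close>

lemma E_pow_equiv:
  assumes "x \<le> p" "x \<le> d" "p \<ge> 1"
  shows "(E ^^ x) (a 0 ^ p) \<approx> of_nat (\<Prod>j<x. d * p - j) * (a 0 ^ (p - 1) * a x)"
proof (rule comb_equiv)
  show "comb a d p x ((E ^^ x) (a 0 ^ p)) (of_nat (\<Prod>j<x. d * p - j))"
    using comb_E_pow[OF comb_pow[of 0 d a p], of x] by simp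
  have "comb a d (p - 1 + 1) (0 * (p - 1) + x) (a 0 ^ (p - 1) * a x) (1 * 1)"
    by (intro comb_mult comb_pow comb_var) (use assms in auto)
  from comb_scale_of_nat[OF this, of "\<Prod>j<x. d * p - j"] assms
  show "comb a d p x (of_nat (\<Prod>j<x. d * p - j) * (a 0 ^ (p - 1) * a x)) (of_nat (\<Prod>j<x. d * p - j))"
    by simp
qed (use assms in auto)

end

section \<open>Rewriting squares and descending from one end of the curve\<close>

lemma binomial_Suc_step: "Suc k * (n choose Suc k) = (n - k) * (n choose k)"
  by (simp only: binomial_absorption binomial_absorb_comp)

text \<open>The ratio (m - k) / (k + 1) of successive binomial coefficients decreases strictly with
  k. Strictness is what makes the pivot coefficient in \<open>square_rewrite\<close>
  nonzero.\<close>

lemma choose_log_concave: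
  assumes "1 \<le> j" "j \<le> m"
  shows "(m choose (j + 1)) * (m choose (j - 1)) < (m choose j)\<^sup>2"
proof -
  obtain i where j: "j = Suc i" using assms by (cases j) auto
  define p q r where "p = (m choose Suc j)" and "q = (m choose j)" and "r = (m choose i)"
  have 1: "Suc j * p = (m - j) * q" unfolding p_def q_def by (rule binomial_Suc_step)
  have 2: "j * q = (m - i) * r" unfolding q_def r_def j by (rule binomial_Suc_step)
  have "(Suc j * (m - i)) * (p * r) = (Suc j * p) * ((m - i) * r)" by (simp only: ac_simps)
  also have "\<dots> = ((m - j) * j) * q\<^sup>2"
    unfolding 1 2[symmetric] by (simp only: power2_eq_square ac_simps)
  also have "\<dots> < (Suc j * (m - i)) * q\<^sup>2"
  proof (rule mult_strict_right_mono)
    have "(m - j) * j \<le> (m - i) * j" using j by (intro mult_right_mono) auto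
    also have "\<dots> < (m - i) * Suc j" using assms j by (intro mult_strict_left_mono) auto
    also have "\<dots> = Suc j * (m - i)" by (rule mult.commute)
    finally show "(m - j) * j < Suc j * (m - i)" .
    show "0 < q\<^sup>2" using assms by (simp add: q_def)
  qed
  finally have "p * r < q\<^sup>2" by (simp only: mult_less_cancel1)
  then show ?thesis by (simp add: p_def q_def r_def j)
qed

lemma const_poly_sum: "const_poly (\<Sum>i\<in>A. f i) = (\<Sum>i\<in>A. const_poly (f i))"
  by (induction A rule: infinite_finite_induct) (simp_all add: const_poly_add)

lemma comb_degree_zero: "comb a d 0 v f s \<Longrightarrow> f = const_poly s"
  by (induction rule: comb.induct) (simp_all add: const_poly_add)

context hess_ideal
begin

text \<open>The Hessian coefficient of weight 2 * x is a combination of products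
  \<open>a k * a l\<close> with k + l = 2 * x, and the square of \<open>a x\<close> occurs in it
  with nonzero coefficient. The square can thus be traded for products with more widely spread
  indices.\<close>

lemma square_rewrite:
  assumes V: "apoly.subspace V" "J \<subseteq> V" and x: "1 \<le> x" "x < d" and ys: "set ys \<subseteq> {..d}"
    and spread: "\<And>k l. k \<le> d \<Longrightarrow> l \<le> d \<Longrightarrow> k + l = 2 * x \<Longrightarrow> k \<noteq> x \<Longrightarrow> a k * (a l * mon a ys) \<in> V"
  shows "a x * (a x * mon a ys) \<in> V"
proof -
  define m where "m = d - 2"
  \<comment> \<open>\<open>hess_gen a d n\<close> has weight n + 2, so this n selects weight 2 *
    x.\<close>
  define n where "n = 2 * x - 2"
  define U where "U = a x * (a x * mon a ys)"
  define C where "C k = (m choose k) * (m choose (n - k))" for k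
  \<comment> \<open>\<open>\<delta> k - \<delta> (k + 1)\<close> is the coefficient of the square of
    \<open>a x\<close> in the k-th bracket of \<open>hess_gen\<close>.\<close>
  define \<delta> :: "nat \<Rightarrow> rat" where "\<delta> k = (if k = x then 1 else 0)" for k
  have summand: "of_nat (C k) * (a i * a j) * mon a ys - const_poly (of_nat (C k) * \<delta> i) * U \<in> V"
    if "k \<le> n" "i + j = 2 * x" "i \<le> k + 1" "j \<le> n - k + 2" for k i j
  proof (cases "C k = 0")
    case True
    then show ?thesis using apoly.subspace_0[OF V(1)] by simp
  next
    case False
    then have "k \<le> m" "n - k \<le> m" by (auto simp: C_def not_less)
    then have ij: "i \<le> d" "j \<le> d" using that d_ge_2 by (auto simp: m_def)
    show ?thesis
    proof (cases "i = x")
      case True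
      then have "j = x" using that by simp
      with True show ?thesis using apoly.subspace_0[OF V(1)]
        by (simp add: \<delta>_def U_def mult.assoc)
    next
      case False
      have "const_poly (of_nat (C k)) * (a i * (a j * mon a ys)) \<in> V"
        by (intro apoly.subspace_scale[OF V(1)] spread) (use ij that False in auto)
      then show ?thesis using False by (simp add: \<delta>_def mult.assoc)
    qed
  qed
  have "of_nat (C k) * (a k * a (n - k + 2) - a (k + 1) * a (n - k + 1)) * mon a ys
      - const_poly (of_nat (C k) * (\<delta> k - \<delta> (k + 1))) * U \<in> V" if "k \<le> n" for k
  proof -
    have "(of_nat (C k) * (a k * a (n - k + 2)) * mon a ys - const_poly (of_nat (C k) * \<delta> k) * U) -
      (of_nat (C k) * (a (k + 1) * a (n - k + 1)) * mon a ys - const_poly (of_nat (C k) * \<delta> (k + 1)) * U) \<in> V"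
      by (intro apoly.subspace_diff[OF V(1)] summand) (use that x in \<open>auto simp: n_def\<close>)
    then show ?thesis by (simp add: const_poly_diff const_poly_mult algebra_simps)
  qed
  then have "(\<Sum>k\<le>n. of_nat (C k) * (a k * a (n - k + 2) - a (k + 1) * a (n - k + 1)) * mon a ys
      - const_poly (of_nat (C k) * (\<delta> k - \<delta> (k + 1))) * U) \<in> V" (is "?S \<in> V")
    by (intro apoly.subspace_sum[OF V(1)]) auto
  have hess: "mon a ys * hess_gen a d n \<in> V" using V J_mult_mon[OF ys J_gen] by blast
  have S: "?S = mon a ys * hess_gen a d n - const_poly (\<Sum>k\<le>n. of_nat (C k) * (\<delta> k - \<delta> (k + 1))) * U"
    unfolding hess_gen_def sum_distrib_left sum_subtractf const_poly_sum sum_distrib_right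
    by (simp add: C_def m_def ac_simps)
  have "const_poly (\<Sum>k\<le>n. of_nat (C k) * (\<delta> k - \<delta> (k + 1))) * U \<in> V"
    using apoly.subspace_diff[OF V(1) hess \<open>?S \<in> V\<close>] unfolding S diff_diff_eq2 add_diff_cancel_left' .
  moreover have "(\<Sum>k\<le>n. of_nat (C k) * (\<delta> k - \<delta> (k + 1))) \<noteq> 0"
  proof -
    have "(\<Sum>k\<le>n. of_nat (C k) * (\<delta> k - \<delta> (k + 1))) = 
       (\<Sum>k\<le>n. if k = x then of_nat (C k) else 0) - (\<Sum>k\<le>n. if k = x - 1 then of_nat (C k) else 0 :: rat)"
      unfolding sum_subtractf[symmetric] by (intro sum.cong) (use x in \<open>auto simp: \<delta>_def\<close>)
    also have "\<dots> = of_nat (if x \<le> n then C x else 0) - of_nat (C (x - 1))"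
      using x by (auto simp: n_def)
    also have "\<dots> \<noteq> 0"
    proof -
      \<comment> \<open>The square arises from k = x and from k = x - 1. For x = 1 the former lies
        outside the range of summation; otherwise strict log-concavity decides.\<close>
      have "(if x \<le> n then C x else 0) < C (x - 1)"
      proof (cases "x = 1")
        case True
        then show ?thesis by (simp add: C_def n_def)
      next
        case False
        have "n - x = x - 2" "n - (x - 1) = x - 1" using x by (auto simp: n_def)
        with choose_log_concave[of "x - 1" m] x False show ?thesis
          by (simp add: C_def m_def power2_eq_square numeral_2_eq_2)
      qed
      then show ?thesis by auto
    qed
    finally show ?thesis .
  qed
  ultimately have "U \<in> V" using subspace_scale_cancel[OF V(1)] by blast
  then show ?thesis by (simp add: U_def)
qed

text \<open>By \<open>E_pow_equiv\<close> a derivative of \<open>a 0 ^ (q + 1)\<close> is a nonzero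
  multiple of \<open>a 0 ^ q * a x\<close> modulo \<open>J\<close>. Both descents lower the exponent
  of \<open>a 0\<close> in this way.\<close>

lemma subspace_pow_var:
  assumes V: "apoly.subspace V" "J \<subseteq> V" and x: "x \<le> q + 1" "x \<le> d" and xs: "set xs \<subseteq> {..d}"
    and "(E ^^ x) (a 0 ^ (q + 1)) * mon a xs \<in> V"
  shows "a 0 ^ q * (a x * mon a xs) \<in> V"
proof -
  let ?c = "\<Prod>j<x. d * (q + 1) - j"
  have "mon a xs * (E ^^ x) (a 0 ^ (q + 1)) - mon a xs * (of_nat ?c * (a 0 ^ (q + 1 - 1) * a x)) \<in> V"
    using eqJ_mult_mon[OF xs E_pow_equiv[of x "q + 1"]] x V by (auto simp: eqJ_def)
  from apoly.subspace_diff[OF V(1) assms(6) this] have "of_nat ?c * (a 0 ^ q * (a x * mon a xs)) \<in> V"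
    by (simp add: ac_simps)
  moreover have "x \<le> d * (q + 1)" using x by (simp add: trans_le_add1)
  then have "?c > 0" by (intro prod_pos) auto
  ultimately show ?thesis using subspace_of_nat_cancel[OF V(1)] by blast
qed

text \<open>In weight D + 1, which is at most n, everything reduces to a multiple of one monomial
  containing \<open>a (D + 1)\<close>. Higher weights follow by descent on the exponent of
  \<open>a 0\<close>: small indices are removed by \<open>subspace_pow_var\<close>, large ones by
  hypothesis, and repeated middle ones are spread by \<open>square_rewrite\<close>.\<close>

lemma high_weight_in_subspace:
  assumes T: "apoly.subspace T" "J \<subseteq> T" and TE: "\<And>f. f \<in> T \<Longrightarrow> E f \<in> T"
    and Tx: "\<And>x xs. D < x \<Longrightarrow> x \<le> d \<Longrightarrow> set xs \<subseteq> {..d} \<Longrightarrow> length xs = n - 1 \<Longrightarrow> a x * mon a xs \<in> T"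
    and D: "D < n" "D < d"
  shows "comb a d n u f s \<Longrightarrow> D < u \<Longrightarrow> f \<in> T"
proof -
  have base: "f \<in> T" if "comb a d n (D + 1) f s" for f s
  proof -
    have "comb a d (n - 1 + 1) (0 * (n - 1) + (D + 1)) (a 0 ^ (n - 1) * a (D + 1)) (1 * 1)"
      by (intro comb_mult comb_pow comb_var) (use D in auto)
    from comb_scale[OF this, of s] D have "comb a d n (D + 1) (const_poly s * (a 0 ^ (n - 1) * a (D + 1))) s"
      by simp
    from comb_equiv[OF that this] D have "f - const_poly s * (a 0 ^ (n - 1) * a (D + 1)) \<in> T"
      using T by (auto simp: eqJ_def)
    moreover have "a (D + 1) * mon a (replicate (n - 1) 0) \<in> T"
      by (rule Tx) (use D in auto)
    then have "a 0 ^ (n - 1) * a (D + 1) \<in> T" by (simp add: mon_def mult.commute)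
    ultimately show ?thesis
      using apoly.subspace_add[OF T(1) _ apoly.subspace_scale[OF T(1)], of "f - const_poly s * (a 0 ^ (n - 1) * a (D + 1))"]
      by (metis diff_add_cancel)
  qed
  \<comment> \<open>The derivatives of the power are carried along because they are what
    \<open>subspace_pow_var\<close> needs for the next r. At r = n the power of \<open>a 0\<close>
    disappears.\<close>
  have claim: "(E ^^ k) (a 0 ^ (n - r)) * g \<in> T"
    if "r \<le> n" "comb a d r u g s" "D < k + u" for r k u g s
    using that
  proof (induction r arbitrary: k u g s)
    case 0
    have *: "(E ^^ (D + 1 + i)) (a 0 ^ n) \<in> T" for i
    proof (induction i)
      case 0
      from comb_E_pow[OF comb_pow[of 0 d a n], of "D + 1"] show ?case
        by (intro base) simp_all
    qed (simp add: TE)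
    show ?case
    proof (cases "u = 0")
      case True
      then have "const_poly s * (E ^^ k) (a 0 ^ n) \<in> T"
        using *[of "k - (D + 1)"] 0 apoly.subspace_scale[OF T(1)] by simp
      then show ?thesis by (simp add: comb_degree_zero[OF 0(2)] mult.commute)
    next
      case False
      then have "g = 0" using comb_degenerate[OF 0(2)] by simp
      then show ?thesis using apoly.subspace_0[OF T(1)] by simp
    qed
  next
    case (Suc r)
    define q where "q = n - Suc r"
    have q: "n - r = q + 1" "n = q + Suc r" using Suc.prems by (auto simp: q_def)
    have mono: "a 0 ^ q * mon a xs \<in> T" if "set xs \<subseteq> {..d}" "length xs = Suc r" "D < sum_list xs" for xs
      using that
    \<comment> \<open>Spreading a square increases the sum of the squares of the indices, which is
      bounded because indices are at most d.\<close>
    proof (induction "d\<^sup>2 * length xs - sum_list (map (\<lambda>x. x\<^sup>2) xs)" arbitrary: xs rule: less_induct)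
      case (less xs)
      consider x where "x \<in> set xs" "x \<le> q + 1" | x where "x \<in> set xs" "D < x"
        | "set xs \<subseteq> {q + 2..D}" by fastforce
      then show ?case
      proof cases
        case 1
        let ?ys = "remove1 x xs"
        have ys: "set ?ys \<subseteq> {..d}" "length ?ys = r" "sum_list xs = x + sum_list ?ys" "x \<le> d"
          using less.prems 1 sum_list_remove1[of x xs] set_remove1_subset[of x xs] by (auto simp: length_remove1)
        have "(E ^^ x) (a 0 ^ (n - r)) * mon a ?ys \<in> T"
          by (rule Suc.IH[OF _ comb_mon[OF ys(1,2) refl]]) (use ys less.prems q in auto)
        then show ?thesis
          using subspace_pow_var[OF T 1(2) ys(4,1)] 1 q by (simp add: mon_remove1)
      next
        case 2
        let ?ys = "replicate q 0 @ remove1 x xs"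
        have "a x * mon a ?ys \<in> T"
          by (rule Tx) (use 2 less.prems q set_remove1_subset[of x xs] in \<open>auto simp: length_remove1\<close>)
        then show ?thesis using 2
          by (simp add: mon_remove1[of x xs] mon_append) (simp add: mon_def mult.left_commute)
      next
        case 3
        \<comment> \<open>The interval \<open>{q + 2..D}\<close> has fewer elements than the n - q
          factors because D < n, so some index repeats.\<close>
        have "\<not> distinct xs"
        proof
          assume "distinct xs"
          then have "card (set xs) = Suc r" using less.prems distinct_card by metis
          moreover have "card (set xs) \<le> card {q + 2..D}" using 3 by (intro card_mono) auto
          ultimately show False using D q by simp
        qed
        then obtain us vs ws x where xs: "xs = us @ [x] @ vs @ [x] @ ws"
          using not_distinct_decomp by blast
        define ys where "ys = replicate q 0 @ us @ vs @ ws"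
        have eq: "a 0 ^ q * mon a xs = a x * (a x * mon a ys)"
          by (simp add: xs ys_def mon_append) (simp add: mon_def ac_simps)
        have x: "q + 2 \<le> x" "x \<le> D" using 3 xs by auto
        show ?thesis unfolding eq
        proof (rule square_rewrite[OF T])
          fix k l assume kl: "k \<le> d" "l \<le> d" "k + l = 2 * x" "k \<noteq> x"
          define zs where "zs = us @ [k] @ vs @ [l] @ ws"
          have "k\<^sup>2 + l\<^sup>2 > 2 * x\<^sup>2"
          proof -
            have "int k + int l = 2 * int x" using kl by linarith
            then have l: "int l = 2 * int x - int k" by simp
            have "(int k - int x)\<^sup>2 > 0" using kl by simp
            then have "(int k)\<^sup>2 + (int l)\<^sup>2 > 2 * (int x)\<^sup>2" unfolding l
              by (simp add: power2_eq_square algebra_simps)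
            then have "int (2 * x\<^sup>2) < int (k\<^sup>2 + l\<^sup>2)" by simp
            then show ?thesis by (simp only: of_nat_less_iff)
          qed
          then have sq: "sum_list (map (\<lambda>x. x\<^sup>2) xs) < sum_list (map (\<lambda>x. x\<^sup>2) zs)"
            by (simp add: xs zs_def)
          have zs: "set zs \<subseteq> {..d}" "length zs = Suc r" "sum_list zs = sum_list xs"
            using less.prems kl by (auto simp: xs zs_def)
          have "sum_list (map (\<lambda>x. x\<^sup>2) zs) \<le> d\<^sup>2 * length (map (\<lambda>x. x\<^sup>2) zs)"
            by (rule sum_list_le) (use zs in \<open>auto intro: power_mono\<close>)
          with sq have "a 0 ^ q * mon a zs \<in> T"
            using zs less.prems by (intro less.hyps) auto
          then show "a k * (a l * mon a ys) \<in> T"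
            by (simp add: zs_def ys_def mon_append) (simp add: mon_def ac_simps)
        qed (use x D less.prems xs ys_def in auto)
      qed
    qed
    have comb0: "a 0 ^ q * g \<in> T" if "comb a d (Suc r) u g s" "D < u" for u g s
    proof -
      have "apoly.subspace {g. a 0 ^ q * g \<in> T}"
        unfolding apoly.subspace_def using apoly.subspace_0[OF T(1)] apoly.subspace_add[OF T(1)]
          apoly.subspace_scale[OF T(1)] by (auto simp: distrib_left mult.left_commute)
      from comb_in_subspace[OF that(1) this] mono that show ?thesis by auto
    qed
    have "(E ^^ k) (a 0 ^ q) * g \<in> T" if "comb a d (Suc r) u g s" "D < k + u" for k u g s
      using that
    proof (induction k arbitrary: u g s)
      case 0
      then show ?case using comb0 by simp
    next
      case (Suc k)
      have "E ((E ^^ k) (a 0 ^ q) * g) \<in> T"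
      proof (cases "D < k + u")
        case True
        then show ?thesis using Suc TE by blast
      next
        case False
        \<comment> \<open>Here k + u = D, just below the reach of the induction hypothesis; but the
          derivative has weight D + 1 and is covered by \<open>base\<close>.\<close>
        have "comb a d (q + Suc r) (0 * q + k + u) ((E ^^ k) (a 0 ^ q) * g) (of_nat (\<Prod>j<k. d * q - 0 * q - j) * 1 * s)"
          by (intro comb_mult comb_E_pow comb_pow Suc.prems) auto
        note comb_E[OF this]
        moreover have "q + Suc r = n" "Suc (0 * q + k + u) = D + 1" using q False Suc.prems by auto
        ultimately show ?thesis using base by metis
      qed
      moreover have "(E ^^ k) (a 0 ^ q) * E g \<in> T"
        using Suc.IH[OF comb_E[OF Suc.prems(1)]] Suc.prems by simp
      ultimately show ?case using apoly.subspace_diff[OF T(1)]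
        by (simp add: E_mult) (metis add_diff_cancel_right')
    qed
    then show ?case using Suc.prems by (simp add: q_def)
  qed
  show "comb a d n u f s \<Longrightarrow> D < u \<Longrightarrow> f \<in> T"
    using claim[of n u f s 0] by simp
qed

end

section \<open>Combining the descents from both ends\<close>

lemma mon_reverse: "mon (\<lambda>i. a (d - i)) xs = mon a (map (\<lambda>i. d - i) xs)"
  by (simp add: mon_def comp_def)

lemma subspace_mult_vimage: "apoly.subspace V \<Longrightarrow> apoly.subspace {f. g * f \<in> V}"
  unfolding apoly.subspace_def by (simp add: distrib_left mult.left_commute[of g])

lemma subspace_sign_cancel: "apoly.subspace V \<Longrightarrow> (- 1) ^ i * f \<in> V \<Longrightarrow> f \<in> V"
  by (cases "even i") (use apoly.subspace_neg in force)+

locale hess_pair = fwd: hess_ideal d a J E + bwd: hess_ideal d "\<lambda>i. a (d - i)" J E'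
  for d a J E E'
begin

text \<open>The operator \<open>E'\<close> sends \<open>a x\<close> to x times
  \<open>a (x - 1)\<close>, so a factor with index at most c is replaced by another such
  factor.\<close>

lemma low_var_span_stable:
  assumes "f \<in> apoly.span (J \<union> {a x * mon a xs | x xs. x \<le> c \<and> set xs \<subseteq> {..d} \<and> length xs = r})" (is "f \<in> ?T")
    and "c \<le> d"
  shows "E' f \<in> ?T"
  using assms(1)
proof (induction rule: apoly.span_induct)
  have "apoly.subspace ?T" by simp
  then show "apoly.subspace {f. E' f \<in> ?T}"
    unfolding apoly.subspace_def by (auto simp: bwd.E_zero bwd.E_add bwd.E_scale)
next
  fix f assume "f \<in> J \<union> {a x * mon a xs | x xs. x \<le> c \<and> set xs \<subseteq> {..d} \<and> length xs = r}"
  then consider "f \<in> J" | x xs where "f = a x * mon a xs" "x \<le> c" "set xs \<subseteq> {..d}" "length xs = r"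
    by blast
  then show "E' f \<in> ?T"
  proof cases
    case 1
    then show ?thesis using bwd.E_J apoly.span_base by blast
  next
    case 2
    have gen: "a y * mon a ys \<in> ?T" if "y \<le> c" "set ys \<subseteq> {..d}" "length ys = r" for y ys
      by (rule apoly.span_base) (use that in blast)
    have "E' (a x) * mon a xs \<in> ?T"
    proof (cases "x = 0")
      case True
      then show ?thesis using bwd.E_var[of d] apoly.span_zero by simp
    next
      case False
      have "const_poly (of_nat x) * (a (x - 1) * mon a xs) \<in> ?T"
        by (intro apoly.span_scale gen) (use 2 in auto)
      then show ?thesis using bwd.E_var[of "d - x"] 2 assms(2) False by (simp add: mult.assoc)
    qed
    moreover have "a x * E' (mon a xs) \<in> ?T"
    proof -
      have "comb (\<lambda>i. a (d - i)) d r (d * r - sum_list xs) (mon a xs) 1"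
        by (rule comb_reverse[OF comb_mon]) (use 2 sum_list_le in auto)
      from bwd.comb_E[OF this] have "E' (mon a xs) \<in> {g. a x * g \<in> ?T}"
      proof (rule comb_in_subspace)
        show "apoly.subspace {g. a x * g \<in> ?T}"
          by (rule subspace_mult_vimage) simp
        fix ys :: "nat list" assume ys: "length ys = r"
        have "a x * mon a (map (\<lambda>i. d - i) ys) \<in> ?T"
          by (rule gen) (use 2 ys in auto)
        then show "mon (\<lambda>i. a (d - i)) ys \<in> {g. a x * g \<in> ?T}" by (simp add: mon_reverse)
      qed
      then show ?thesis by simp
    qed
    ultimately show ?thesis using apoly.span_add 2 by (simp add: bwd.E_mult)
  qed
qed

text \<open>The induction runs over the degree r of the cofactor of \<open>a 0 ^ (t - r)\<close>.
  The bound on t enters through \<open>D < n\<close> and through the arithmetic of the case in which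
  the exponent p is at least n.\<close>

theorem comb_in_stable_subspace:
  assumes B: "apoly.subspace B" "J \<subseteq> B" and BE: "\<And>f. f \<in> B \<Longrightarrow> E f \<in> B"
    and Bt: "\<And>k. (E ^^ k) (a 0 ^ t) \<in> B" and t: "d + 2 \<le> t"
  shows "comb a d t v f s \<Longrightarrow> f \<in> B"
proof -
  have claim: "(E ^^ k) (a 0 ^ (t - r)) * g \<in> B" if "r \<le> t" "comb a d r u g s" for r k u g s
    using that
  proof (induction r arbitrary: k u g s)
    case 0
    then show ?case using apoly.subspace_scale[OF B(1) Bt[of k], of s]
      by (simp add: comb_degree_zero[OF 0(2)] mult.commute)
  next
    case (Suc r)
    define p where "p = t - Suc r"
    define n where "n = Suc r"
    define A where "A = a 0 ^ p"
    have p: "t - r = p + 1" "n + p = t" "n \<ge> 1" using Suc.prems by (auto simp: p_def n_def)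
    have low: "A * (a x * mon a xs) \<in> B" if "x \<le> p + 1" "x \<le> d" "set xs \<subseteq> {..d}" "length xs = r" for x xs
      unfolding A_def
    proof (rule fwd.subspace_pow_var[OF B that(1-3)])
      show "(E ^^ x) (a 0 ^ (p + 1)) * mon a xs \<in> B"
        using Suc.IH[OF _ comb_mon[OF that(3,4) refl]] Suc.prems p by simp
    qed
    have A0: "A * g \<in> B" if "comb a d n u g s" for u g s
    \<comment> \<open>In the first case every index is at most p + 1, so \<open>low\<close> covers
      all monomials.\<close>
    proof (cases "d \<le> p + 1")
      case True
      have "A * mon a xs \<in> B" if "set xs \<subseteq> {..d}" "length xs = n" for xs
      proof (cases xs)
        case Nil
        then show ?thesis using that p by simp
      next
        case (Cons y ys)
        then show ?thesis using low[of y ys] that True by (auto simp: n_def)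
      qed
      then show ?thesis
        using comb_in_subspace[OF that subspace_mult_vimage[OF B(1), of A]] by blast
    next
      case False
      \<comment> \<open>An index x > D in the reversed numbering is an index d - x <= p + 1 in the
        original one. This matches the hypothesis on large indices in
        \<open>bwd.high_weight_in_subspace\<close>.\<close>
      define D where "D = d - (p + 2)"
      have D: "D + (p + 2) = d" "D < n" "D < d" using False t p by (auto simp: D_def)
      define T where "T = apoly.span (J \<union> {a x * mon a xs | x xs. x \<le> p + 1 \<and> set xs \<subseteq> {..d} \<and> length xs = r})"
      have T: "apoly.subspace T" "J \<subseteq> T" by (auto simp: T_def intro: apoly.span_base)
      have TE: "E' f \<in> T" if "f \<in> T" for f
        using low_var_span_stable[of f "p + 1" r] that D by (simp add: T_def)
      have TB: "A * f \<in> B" if "f \<in> T" for f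
      proof -
        have "T \<subseteq> {f. A * f \<in> B}" unfolding T_def
        proof (rule apoly.span_minimal[OF _ subspace_mult_vimage[OF B(1)]])
          have "A * f \<in> B" if "f \<in> J" for f
            using fwd.J_mult_pow[OF _ that, of 0 p] B(2) by (auto simp: A_def)
          then show "J \<union> {a x * mon a xs | x xs. x \<le> p + 1 \<and> set xs \<subseteq> {..d} \<and> length xs = r} \<subseteq> {f. A * f \<in> B}"
            using low D by auto
        qed
        with that show ?thesis by blast
      qed
      have lowW: "A * f \<in> B" if "comb a d n v f s" "v + D < d * n" for v f s
      proof (rule TB, rule bwd.high_weight_in_subspace[OF T TE])
        show "comb (\<lambda>i. a (d - i)) d n (d * n - v) f s" using that by (intro comb_reverse) auto
        show "D < d * n - v" using that by simp
        fix x xs assume x: "D < x" "x \<le> d" "set xs \<subseteq> {..d}" "length xs = n - 1"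
        show "a (d - x) * mon (\<lambda>i. a (d - i)) xs \<in> T"
          unfolding T_def mon_reverse
        proof (intro apoly.span_base UnI2 CollectI exI conjI)
          show "d - x \<le> p + 1" "length (map (\<lambda>i. d - i) xs) = r" using x D by (auto simp: n_def)
        qed auto
      qed (use D in auto)
      have "A * f \<in> B" if "comb a d n W f s" for W f s
        using that
      proof (induction W arbitrary: f s rule: less_induct)
        case (less W)
        consider "W > d * n" | "W + D < d * n" | "W \<le> d * n" "d * n \<le> W + D" by linarith
        then show ?case
        proof cases
          case 1
          then show ?thesis using comb_degenerate[OF less.prems] apoly.subspace_0[OF B(1)] by simp
        next
          case 2
          then show ?thesis using lowW less.prems by blast
        next
          case 3
          have below: "(E ^^ i) A * g \<in> B" if "comb a d n u g s" "u + i < W" for u i g s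
            using that
          proof (induction i arbitrary: u g s)
            case 0
            then show ?case using less.IH by simp
          next
            case (Suc i)
            have "E ((E ^^ i) A * g) - (E ^^ i) A * E g \<in> B"
              using Suc.prems Suc.IH[OF fwd.comb_E[OF Suc.prems(1)]]
              by (intro apoly.subspace_diff[OF B(1)] BE Suc.IH[OF Suc.prems(1)]) auto
            then show ?case by (simp add: fwd.E_mult)
          qed
          \<comment> \<open>Integration by parts: as long as the weight of g plus the number of
            derivatives stays below W, the product lies in \<open>B\<close> by \<open>below\<close>,
            and so does its derivative. Hence \<open>E\<close> moves from one factor to the other at
            the price of a sign.\<close>
          have alt: "(E ^^ i) A * g - (- 1) ^ i * (A * (E ^^ i) g) \<in> B"
            if "comb a d n u g s" "u + i = W" for u i g s
            using that
          proof (induction i arbitrary: u g s)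
            case 0
            then show ?case using apoly.subspace_0[OF B(1)] by simp
          next
            case (Suc i)
            have "E ((E ^^ i) A * g) \<in> B"
              using Suc.prems by (intro BE below[OF Suc.prems(1)]) auto
            moreover have "(E ^^ i) A * E g - (- 1) ^ i * (A * (E ^^ i) (E g)) \<in> B"
              using Suc.prems by (intro Suc.IH[OF fwd.comb_E[OF Suc.prems(1)]]) auto
            ultimately have "E ((E ^^ i) A * g) - ((E ^^ i) A * E g - (- 1) ^ i * (A * (E ^^ i) (E g))) \<in> B"
              by (rule apoly.subspace_diff[OF B(1)])
            then show ?case by (simp add: fwd.E_mult funpow_swap1)
          qed
          \<comment> \<open>Within D of the maximal weight all elements of weight W are determined
            modulo \<open>J\<close> by their coefficient sum, so a single \<open>h\<close> with
            nonzero sum suffices.\<close>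
          obtain h c where h: "comb a d n W h c" "A * h \<in> B" "c \<noteq> 0"
          proof (cases "p < n")
            case True
            have "d * (p + 1) \<le> d * n" using True by (intro mult_left_mono) auto
            then have W: "d * p + 1 \<le> W" using 3 D by simp
            have "W - (d * p + 1) \<le> d * n" using 3 by simp
            then obtain xs where xs: "set xs \<subseteq> {..d}" "length xs = n" "sum_list xs = W - (d * p + 1)"
              using ex_list_of_weight by blast
            note g = comb_mon[OF xs, of a]
            \<comment> \<open>Degree p admits no weight above d * p. After moving d * p + 1
              derivatives the side with the power of \<open>a 0\<close> is therefore zero.\<close>
            have "(E ^^ (d * p + 1)) A = 0"
              using comb_degenerate[OF fwd.comb_E_pow[OF comb_pow[of 0 d a p], of "d * p + 1"]] by (simp add: A_def)
            with alt[OF g, of "d * p + 1"] W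
            have *: "- ((- 1) ^ (d * p + 1) * (A * (E ^^ (d * p + 1)) (mon a xs))) \<in> B" by simp
            have "A * (E ^^ (d * p + 1)) (mon a xs) \<in> B"
              using subspace_sign_cancel[OF B(1)] apoly.subspace_neg[OF B(1) *] by (metis minus_minus)
            moreover have "comb a d n W ((E ^^ (d * p + 1)) (mon a xs)) (of_nat (\<Prod>j<d * p + 1. d * n - (W - (d * p + 1)) - j) * 1)"
              using fwd.comb_E_pow[OF g, of "d * p + 1"] W by simp
            moreover have pos: "(\<Prod>j<d * p + 1. d * n - (W - (d * p + 1)) - j) > 0"
              by (intro prod_pos) (use W 3 in auto)
            have "of_nat (\<Prod>j<d * p + 1. d * n - (W - (d * p + 1)) - j) * 1 \<noteq> (0 :: rat)"
              unfolding mult_1_right of_nat_eq_0_iff using pos by linarith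
            ultimately show ?thesis using that by blast
          next
            case False
            have p2: "d + 2 \<le> 2 * p" "p \<le> d" "4 \<le> n" using False p t D by auto
            have "d * 4 \<le> d * n" using p2 by (intro mult_left_mono) auto
            moreover have "d * n = d * r + d" by (simp add: n_def)
            \<comment> \<open>The offset 2 * p - 1 is the sum of the indices p and p - 1, one of
              which is prefixed to \<open>ys\<close> in \<open>g1\<close> and the other in
              \<open>g2\<close>.\<close>
            ultimately have W: "2 * p - 1 \<le> W" "W - (2 * p - 1) \<le> d * r"
              using 3 D(3) p2 by linarith+
            then obtain ys where ys: "set ys \<subseteq> {..d}" "length ys = r" "sum_list ys = W - (2 * p - 1)"
              using ex_list_of_weight by blast
            define c1 c2 where "c1 = (\<Prod>j<p - 1. d * p - j)" and "c2 = (\<Prod>j<p. d * p - j)"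
            define e1 e2 where "e1 = (\<Prod>j<p - 1. d * n - (W - (p - 1)) - j)"
              and "e2 = (\<Prod>j<p. d * n - (W - p) - j)"
            \<comment> \<open>Modulo \<open>J\<close> both \<open>(E ^^ (p - 1)) A * g1\<close> and
              \<open>(E ^^ p) A * g2\<close> are multiples, by \<open>c1\<close> and
              \<open>c2\<close>, of the same product of \<open>a 0 ^ (p - 1)\<close>,
              \<open>a (p - 1)\<close>, \<open>a p\<close> and \<open>mon a ys\<close>. Moving the
              derivatives onto \<open>g1\<close> and \<open>g2\<close> yields opposite signs, so
              eliminating this product leaves the positive combination \<open>h\<close>.\<close>
            define g1 g2 where "g1 = mon a (p # ys)" and "g2 = mon a ((p - 1) # ys)"
            have g1: "comb a d n (W - (p - 1)) g1 1"
              unfolding g1_def by (rule comb_mon) (use ys p2 W in \<open>auto simp: n_def\<close>)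
            have g2: "comb a d n (W - p) g2 1"
              unfolding g2_def by (rule comb_mon) (use ys p2 W in \<open>auto simp: n_def\<close>)
            have Ep1: "mon a (p # ys) * (E ^^ (p - 1)) A - mon a (p # ys) * (of_nat c1 * (a 0 ^ (p - 1) * a (p - 1))) \<in> B"
              using fwd.eqJ_mult_mon[OF _ fwd.E_pow_equiv[of "p - 1" p], of "p # ys"] p2 ys B(2)
              by (auto simp: fwd.eqJ_def A_def c1_def)
            have Ep2: "mon a ((p - 1) # ys) * (E ^^ p) A - mon a ((p - 1) # ys) * (of_nat c2 * (a 0 ^ (p - 1) * a p)) \<in> B"
              using fwd.eqJ_mult_mon[OF _ fwd.E_pow_equiv[of p p], of "(p - 1) # ys"] p2 ys B(2)
              by (auto simp: fwd.eqJ_def A_def c2_def)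
            have al1: "(E ^^ (p - 1)) A * g1 - (- 1) ^ (p - 1) * (A * (E ^^ (p - 1)) g1) \<in> B"
              by (rule alt[OF g1]) (use W p2 in auto)
            have al2: "(E ^^ p) A * g2 - (- 1) ^ p * (A * (E ^^ p) g2) \<in> B"
              by (rule alt[OF g2]) (use W p2 in auto)
            define h where "h = of_nat c2 * (E ^^ (p - 1)) g1 + of_nat c1 * (E ^^ p) g2"
            have odd: "(- 1) ^ p = - ((- 1) ^ (p - 1) :: apoly)"
              using p2 by (cases p) auto
            have "const_poly (of_nat c2) * ((mon a (p # ys) * (E ^^ (p - 1)) A - mon a (p # ys) * (of_nat c1 * (a 0 ^ (p - 1) * a (p - 1))))
                  - ((E ^^ (p - 1)) A * g1 - (- 1) ^ (p - 1) * (A * (E ^^ (p - 1)) g1)))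
                - const_poly (of_nat c1) * ((mon a ((p - 1) # ys) * (E ^^ p) A - mon a ((p - 1) # ys) * (of_nat c2 * (a 0 ^ (p - 1) * a p)))
                  - ((E ^^ p) A * g2 - (- 1) ^ p * (A * (E ^^ p) g2))) \<in> B" (is "?X \<in> B")
              by (intro apoly.subspace_diff[OF B(1)] apoly.subspace_scale[OF B(1)] Ep1 Ep2 al1 al2)
            moreover have "?X = (- 1) ^ (p - 1) * (A * h)"
              unfolding odd h_def g1_def g2_def by (simp add: algebra_simps)
            ultimately have "(- 1) ^ (p - 1) * (A * h) \<in> B" by simp
            then have "A * h \<in> B"
              using subspace_sign_cancel[OF B(1)] by blast
            moreover have "comb a d n W h (of_nat c2 * (of_nat e1 * 1) + of_nat c1 * (of_nat e2 * 1))"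
              unfolding h_def
            proof (rule comb_add)
              have "W - (p - 1) + (p - 1) = W" "W - p + p = W" using W p2 by auto
              then show "comb a d n W (of_nat c2 * (E ^^ (p - 1)) g1) (of_nat c2 * (of_nat e1 * 1))"
                "comb a d n W (of_nat c1 * (E ^^ p) g2) (of_nat c1 * (of_nat e2 * 1))"
                using comb_scale_of_nat[OF fwd.comb_E_pow[OF g1, of "p - 1"], of c2]
                  comb_scale_of_nat[OF fwd.comb_E_pow[OF g2, of p], of c1]
                by (simp_all only: e1_def e2_def)
            qed
            moreover have "of_nat c2 * (of_nat e1 * 1) + of_nat c1 * (of_nat e2 * 1) \<noteq> (0 :: rat)"
            proof -
              have "p \<le> d * p" using fwd.d_ge_2 by simp
              then have "j < d * p" if "j < p" for j using that by linarith
              then have "c1 > 0" "c2 > 0"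
                unfolding c1_def c2_def by (auto intro!: prod_pos simp del: mult_le_cancel2 mult_less_cancel2)
              moreover have "e1 > 0" "e2 > 0"
                unfolding e1_def e2_def using W 3 p2 by (auto intro!: prod_pos)
              ultimately show ?thesis by (simp flip: of_nat_mult of_nat_add)
            qed
            ultimately show ?thesis using that by blast
          qed
          have "comb a d n W (const_poly (s / c) * h) s"
            using comb_scale[OF h(1), of "s / c"] h(3) by simp
          \<comment> \<open>The reversed weight d * n - W is at most D < n, so the comparison from
            the other end applies.\<close>
          then have "f - const_poly (s / c) * h \<in> J"
            using bwd.comb_equiv[OF comb_reverse[OF less.prems] comb_reverse] 3 D by (auto simp: bwd.eqJ_def)
          then have "A * (f - const_poly (s / c) * h) \<in> B"
            using fwd.J_mult_pow[of 0 _ p] B(2) by (auto simp: A_def)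
          from apoly.subspace_add[OF B(1) this apoly.subspace_scale[OF B(1) h(2), of "s / c"]]
          show ?thesis by (simp add: right_diff_distrib mult.left_commute)
        qed
      qed
      with that show ?thesis by blast
    qed
    have "(E ^^ k) A * g \<in> B" if "comb a d n u g s" for k u g s
      using that
    proof (induction k arbitrary: u g s)
      case 0
      then show ?case using A0 by simp
    next
      case (Suc k)
      have "E ((E ^^ k) A * g) - (E ^^ k) A * E g \<in> B"
        using Suc.prems Suc.IH[OF fwd.comb_E[OF Suc.prems(1)]]
        by (intro apoly.subspace_diff[OF B(1)] BE Suc.IH[OF Suc.prems(1)]) auto
      then show ?case by (simp add: fwd.E_mult)
    qed
    with Suc.prems show ?case by (simp add: A_def p_def n_def)
  qed
  show "comb a d t v f s \<Longrightarrow> f \<in> B"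
    using claim[of t v f s 0] by simp
qed

end

section \<open>The polynomial ring and its derivations\<close>

definition mterm :: "mono \<Rightarrow> apoly" where
  "mterm m = Poly_Mapping.single m 1"

lemma mterm_zero [simp]: "mterm 0 = 1"
  by (simp add: mterm_def)

lemma mterm_add: "mterm (m + m') = mterm m * mterm m'"
  by (simp add: mterm_def mult_single)

lemma avar_mterm: "avar i = mterm (Poly_Mapping.single i 1)"
  by (simp add: avar_def mterm_def)

lemma const_poly_mterm: "const_poly c * mterm m = Poly_Mapping.single m c"
  by (simp add: const_poly_def mterm_def mult_single)

lemma lookup_const_mult: "Poly_Mapping.lookup (const_poly c * f) m = c * Poly_Mapping.lookup f m"
proof -
  have "const_poly c * f = Poly_Mapping.map ((*) c) f"
    by (simp add: const_poly_def mult_map_scale_conv_mult)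
  then show ?thesis by (simp add: map.rep_eq when_def)
qed

lemma apoly_expand:
  assumes "finite A" "Poly_Mapping.keys f \<subseteq> A"
  shows "f = (\<Sum>m\<in>A. const_poly (Poly_Mapping.lookup f m) * mterm m)"
proof (rule poly_mapping_eqI)
  fix k
  have "Poly_Mapping.lookup (\<Sum>m\<in>A. const_poly (Poly_Mapping.lookup f m) * mterm m) k
      = (\<Sum>m\<in>A. if m = k then Poly_Mapping.lookup f k else 0)"
    unfolding lookup_sum const_poly_mterm by (intro sum.cong) (auto simp: lookup_single when_def)
  also have "\<dots> = Poly_Mapping.lookup f k"
    using assms by (auto simp: in_keys_iff)
  finally show "Poly_Mapping.lookup f k = Poly_Mapping.lookup (\<Sum>m\<in>A. const_poly (Poly_Mapping.lookup f m) * mterm m) k"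
    by simp
qed

lemma subspace_all_mterms:
  assumes "apoly.subspace V" "\<And>m. m \<in> Poly_Mapping.keys f \<Longrightarrow> mterm m \<in> V"
  shows "f \<in> V"
  by (subst apoly_expand[of "Poly_Mapping.keys f" f])
    (auto intro!: apoly.subspace_sum[OF assms(1)] apoly.subspace_scale[OF assms(1)] assms(2))

definition lin_ext :: "(mono \<Rightarrow> apoly) \<Rightarrow> apoly \<Rightarrow> apoly" where
  "lin_ext g f = (\<Sum>m\<in>Poly_Mapping.keys f. const_poly (Poly_Mapping.lookup f m) * g m)"

lemma lin_ext_superset:
  assumes "finite A" "Poly_Mapping.keys f \<subseteq> A"
  shows "lin_ext g f = (\<Sum>m\<in>A. const_poly (Poly_Mapping.lookup f m) * g m)"
  unfolding lin_ext_def using assms by (intro sum.mono_neutral_left) (auto simp: in_keys_iff)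

lemma lin_ext_add: "lin_ext g (f + h) = lin_ext g f + lin_ext g h"
proof -
  let ?A = "Poly_Mapping.keys f \<union> Poly_Mapping.keys h"
  have "Poly_Mapping.keys (f + h) \<subseteq> ?A" by (rule keys_add)
  then show ?thesis
    by (simp add: lin_ext_superset[of ?A] lookup_add const_poly_add distrib_right sum.distrib)
qed

lemma lin_ext_scale: "lin_ext g (const_poly c * f) = const_poly c * lin_ext g f"
proof -
  have "Poly_Mapping.keys (const_poly c * f) \<subseteq> Poly_Mapping.keys f"
    by (auto simp: in_keys_iff lookup_const_mult)
  from lin_ext_superset[OF finite_keys this] show ?thesis
    by (simp only: lin_ext_def lookup_const_mult const_poly_mult sum_distrib_left mult.assoc)
qed

lemma lin_ext_mterm [simp]: "lin_ext g (mterm m) = g m"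
  by (simp add: lin_ext_def mterm_def)

lemma lin_ext_zero [simp]: "lin_ext g 0 = 0"
  by (simp add: lin_ext_def)

lemma subspace_lin_ext_vimage:
  assumes "apoly.subspace V"
  shows "apoly.subspace {f. lin_ext g f \<in> V}"
proof (rule apoly.subspaceI)
  show "0 \<in> {f. lin_ext g f \<in> V}" using apoly.subspace_0[OF assms] by simp
qed (simp_all only: mem_Collect_eq lin_ext_add lin_ext_scale apoly.subspace_add[OF assms] apoly.subspace_scale[OF assms])

definition derivation :: "(nat \<Rightarrow> apoly) \<Rightarrow> apoly \<Rightarrow> apoly" where
  "derivation h = lin_ext (\<lambda>m. \<Sum>i\<in>Poly_Mapping.keys m.
     of_nat (Poly_Mapping.lookup m i) * (mterm (m - Poly_Mapping.single i 1) * h i))"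

lemma derivation_mterm:
  assumes "finite A" "Poly_Mapping.keys m \<subseteq> A"
  shows "derivation h (mterm m) = (\<Sum>i\<in>A. of_nat (Poly_Mapping.lookup m i) * (mterm (m - Poly_Mapping.single i 1) * h i))"
  unfolding derivation_def lin_ext_mterm using assms by (intro sum.mono_neutral_left) (auto simp: in_keys_iff)

lemma derivation_avar [simp]: "derivation h (avar i) = h i"
  by (simp add: avar_mterm derivation_mterm[of "{i}"])

lemma derivation_mterm_mult:
  "derivation h (mterm m * mterm m') = derivation h (mterm m) * mterm m' + mterm m * derivation h (mterm m')"
proof -
  let ?A = "Poly_Mapping.keys m \<union> Poly_Mapping.keys m'"
  \<comment> \<open>Subtraction of exponents is truncated and commutes with adding \<open>n'\<close>
    only where \<open>n\<close> has a positive exponent at i; elsewhere the coefficient is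
    zero.\<close>
  have 1: "of_nat (Poly_Mapping.lookup n i) * mterm (n + n' - Poly_Mapping.single i 1)
      = of_nat (Poly_Mapping.lookup n i) * (mterm (n - Poly_Mapping.single i 1) * mterm n')" for n n' i
  proof (cases "Poly_Mapping.lookup n i = 0")
    case False
    have "n + n' - Poly_Mapping.single i 1 = (n - Poly_Mapping.single i 1) + n'"
      using False by (intro poly_mapping_eqI) (auto simp: lookup_add lookup_minus lookup_single when_def)
    then show ?thesis by (simp add: mterm_add)
  qed simp
  have "derivation h (mterm m * mterm m') = (\<Sum>i\<in>?A. of_nat (Poly_Mapping.lookup m i) * mterm (m + m' - Poly_Mapping.single i 1) * h i
      + of_nat (Poly_Mapping.lookup m' i) * mterm (m' + m - Poly_Mapping.single i 1) * h i)"
    unfolding mterm_add[symmetric] using keys_add[of m m']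
    by (simp add: derivation_mterm[of ?A] lookup_add distrib_right mult.assoc add.commute)
  also have "\<dots> = derivation h (mterm m) * mterm m' + mterm m * derivation h (mterm m')"
    unfolding 1 by (simp add: derivation_mterm[of ?A] sum.distrib sum_distrib_left sum_distrib_right ac_simps)
  finally show ?thesis .
qed

lemma derivation_add: "derivation h (f + g) = derivation h f + derivation h g"
  and derivation_scale: "derivation h (const_poly c * f) = const_poly c * derivation h f"
  and derivation_zero: "derivation h 0 = 0"
  by (simp_all add: derivation_def lin_ext_add lin_ext_scale)

text \<open>Both sides are bilinear in f and g, so the case of two monomials suffices.\<close>

lemma derivation_mult: "derivation h (f * g) = derivation h f * g + f * derivation h g"
proof -
  have 1: "derivation h (mterm m * g) = derivation h (mterm m) * g + mterm m * derivation h g" for m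
  proof -
    have "apoly.subspace {g. derivation h (mterm m * g) = derivation h (mterm m) * g + mterm m * derivation h g}"
      unfolding apoly.subspace_def
      by (auto simp: derivation_add derivation_scale distrib_left mult.left_commute[of "mterm m"]
          mult.left_commute[of "derivation h (mterm m)"] derivation_zero)
    from subspace_all_mterms[OF this] show ?thesis using derivation_mterm_mult by blast
  qed
  have "apoly.subspace {f. derivation h (f * g) = derivation h f * g + f * derivation h g}"
    unfolding apoly.subspace_def
    by (auto simp: derivation_add derivation_scale distrib_left distrib_right mult.assoc
        derivation_zero)
  from subspace_all_mterms[OF this] show ?thesis using 1 by blast
qed

section \<open>Degree and weight of monomials\<close>

lemma mon_avar: "mon avar xs = mterm (\<Sum>i\<leftarrow>xs. Poly_Mapping.single i 1)"
  by (induction xs) (simp_all add: avar_mterm mterm_add)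

definition weight :: "mono \<Rightarrow> nat" where
  "weight m = (\<Sum>i\<in>Poly_Mapping.keys m. i * Poly_Mapping.lookup m i)"

lemma mono_degree_superset:
  assumes "finite A" "Poly_Mapping.keys m \<subseteq> A"
  shows "mono_degree m = (\<Sum>i\<in>A. Poly_Mapping.lookup m i)"
  unfolding mono_degree_def using assms by (intro sum.mono_neutral_left) (auto simp: in_keys_iff)

lemma weight_superset:
  assumes "finite A" "Poly_Mapping.keys m \<subseteq> A"
  shows "weight m = (\<Sum>i\<in>A. i * Poly_Mapping.lookup m i)"
  unfolding weight_def using assms by (intro sum.mono_neutral_left) (auto simp: in_keys_iff)

lemma mono_degree_add: "mono_degree (m + m') = mono_degree m + mono_degree m'"
  and weight_add: "weight (m + m') = weight m + weight m'"
  using keys_add[of m m']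
  by (simp_all add: mono_degree_superset[of "Poly_Mapping.keys m \<union> Poly_Mapping.keys m'"]
      weight_superset[of "Poly_Mapping.keys m \<union> Poly_Mapping.keys m'"] lookup_add sum.distrib distrib_left)

lemma mono_degree_single [simp]: "mono_degree (Poly_Mapping.single i n) = n"
  and weight_single [simp]: "weight (Poly_Mapping.single i n) = i * n"
  by (simp_all add: mono_degree_superset[of "{i}"] weight_superset[of "{i}"])

lemma mono_degree_zero [simp]: "mono_degree 0 = 0" and weight_zero [simp]: "weight 0 = 0"
  by (simp_all add: mono_degree_def weight_def)

lemma mono_degree_of_list: "mono_degree (\<Sum>i\<leftarrow>xs. Poly_Mapping.single i 1) = length xs"
  and weight_of_list: "weight (\<Sum>i\<leftarrow>xs. Poly_Mapping.single i 1) = sum_list xs"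
  by (induction xs) (simp_all add: mono_degree_add weight_add)

lemma ex_list_of_mono:
  fixes m :: mono
  shows "\<exists>xs. m = (\<Sum>i\<leftarrow>xs. Poly_Mapping.single i 1) \<and> set xs \<subseteq> Poly_Mapping.keys m"
proof (induction "mono_degree m" arbitrary: m)
  case 0
  then have "\<forall>i\<in>Poly_Mapping.keys m. Poly_Mapping.lookup m i = 0"
    unfolding mono_degree_def by simp
  then have "m = 0" by (intro poly_mapping_eqI) (auto simp: in_keys_iff)
  then show ?case by (intro exI[of _ "[]"]) simp
next
  case (Suc n)
  then have "m \<noteq> 0" by auto
  then obtain i where i: "i \<in> Poly_Mapping.keys m" by (metis all_not_in_conv keys_eq_empty)
  define m' where "m' = m - Poly_Mapping.single i 1"
  have m: "m = Poly_Mapping.single i 1 + m'"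
    using i unfolding m'_def
    by (intro poly_mapping_eqI) (auto simp: lookup_add lookup_minus lookup_single when_def in_keys_iff)
  then have "n = mono_degree m'" using Suc.hyps(2) by (simp add: mono_degree_add)
  then obtain xs where xs: "m' = (\<Sum>i\<leftarrow>xs. Poly_Mapping.single i 1)" "set xs \<subseteq> Poly_Mapping.keys m'"
    using Suc.hyps(1) by blast
  have "Poly_Mapping.keys m' \<subseteq> Poly_Mapping.keys m"
    by (auto simp: m'_def in_keys_iff lookup_minus)
  then show ?case using m xs i by (intro exI[of _ "i # xs"]) auto
qed

text \<open>This passes from exponent vectors to the index lists on which the descent works.\<close>

lemma mterm_eq_mon:
  assumes "Poly_Mapping.keys m \<subseteq> {..d}"
  obtains xs where "mterm m = mon avar xs" "set xs \<subseteq> {..d}" "length xs = mono_degree m" "sum_list xs = weight m"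
  using ex_list_of_mono[of m] assms that mon_avar mono_degree_of_list weight_of_list by (metis order_trans)

section \<open>The coordinate ring and its ideals\<close>

lemma carrier_coord_ring: "f \<in> carrier (coord_ring d) \<longleftrightarrow> (\<forall>m\<in>Poly_Mapping.keys f. Poly_Mapping.keys m \<subseteq> {..d})"
  by (simp add: coord_ring_def atLeast0AtMost)

lemma coord_ring_simps [simp]:
  "mult (coord_ring d) = (*)" "one (coord_ring d) = 1" "zero (coord_ring d) = 0" "add (coord_ring d) = (+)"
  by (simp_all add: coord_ring_def)

lemma coord_ring_subspace: "apoly.subspace (carrier (coord_ring d))"
proof (rule apoly.subspaceI)
  fix f g assume "f \<in> carrier (coord_ring d)" "g \<in> carrier (coord_ring d)"
  then show "f + g \<in> carrier (coord_ring d)"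
    unfolding carrier_coord_ring using keys_add[of f g] by blast
next
  fix c f assume "f \<in> carrier (coord_ring d)"
  then show "const_poly c * f \<in> carrier (coord_ring d)"
    unfolding carrier_coord_ring by (simp add: in_keys_iff lookup_const_mult)
qed (simp add: carrier_coord_ring)

lemma coord_ring_mult:
  assumes "f \<in> carrier (coord_ring d)" "g \<in> carrier (coord_ring d)"
  shows "f * g \<in> carrier (coord_ring d)"
  unfolding carrier_coord_ring
proof
  fix m assume "m \<in> Poly_Mapping.keys (f * g)"
  then obtain k l where "m = k + l" "k \<in> Poly_Mapping.keys f" "l \<in> Poly_Mapping.keys g"
    using keys_mult[of f g] by blast
  then show "Poly_Mapping.keys m \<subseteq> {..d}"
    using assms keys_add[of k l] unfolding carrier_coord_ring by blast
qed

lemma coord_ring_one: "1 \<in> carrier (coord_ring d)"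
  by (simp add: carrier_coord_ring)

lemma coord_ring_const: "const_poly c \<in> carrier (coord_ring d)"
  using apoly.subspace_scale[OF coord_ring_subspace coord_ring_one, of c d] by simp

lemma coord_ring_avar: "i \<le> d \<Longrightarrow> avar i \<in> carrier (coord_ring d)"
  by (simp add: carrier_coord_ring avar_def)

lemma coord_ring_mon: "set xs \<subseteq> {..d} \<Longrightarrow> mon avar xs \<in> carrier (coord_ring d)"
  by (induction xs) (auto intro: coord_ring_one coord_ring_mult coord_ring_avar)

lemma coord_ring_cring: "cring (coord_ring d)"
proof (rule cringI)
  show "abelian_group (coord_ring d)"
  proof (rule abelian_groupI)
    fix x assume "x \<in> carrier (coord_ring d)"
    then have "- x \<in> carrier (coord_ring d)" by (rule apoly.subspace_neg[OF coord_ring_subspace])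
    then show "\<exists>y\<in>carrier (coord_ring d). y \<oplus>\<^bsub>coord_ring d\<^esub> x = \<zero>\<^bsub>coord_ring d\<^esub>" by force
  qed (simp_all add: apoly.subspace_add[OF coord_ring_subspace] apoly.subspace_0[OF coord_ring_subspace] ac_simps)
  show "Group.comm_monoid (coord_ring d)"
    by (rule comm_monoidI) (simp_all add: coord_ring_mult coord_ring_one ac_simps)
qed (simp add: distrib_right)

lemma subspace_contains_coord_ring:
  assumes "apoly.subspace V" "\<And>xs. set xs \<subseteq> {..d} \<Longrightarrow> mon avar xs \<in> V" "f \<in> carrier (coord_ring d)"
  shows "f \<in> V"
  using assms(1)
proof (rule subspace_all_mterms)
  fix m assume "m \<in> Poly_Mapping.keys f"
  then have "Poly_Mapping.keys m \<subseteq> {..d}" using assms(3) by (simp add: carrier_coord_ring)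
  then show "mterm m \<in> V" by (rule mterm_eq_mon) (use assms(2) in auto)
qed

text \<open>Closure under scalars and variables is enough because the monomials span the
  ring.\<close>

lemma coord_ring_idealI:
  assumes "apoly.subspace I" "I \<subseteq> carrier (coord_ring d)" "\<And>i f. i \<le> d \<Longrightarrow> f \<in> I \<Longrightarrow> avar i * f \<in> I"
  shows "ideal I (coord_ring d)"
proof (rule idealI)
  show "ring (coord_ring d)" using coord_ring_cring by (simp add: cring_def)
  show "subgroup I (add_monoid (coord_ring d))"
  proof (rule group.subgroupI)
    show *: "Group.group (add_monoid (coord_ring d))"
      using coord_ring_cring abelian_group.a_group cring.is_cring by (meson abelian_group.a_group cring_def ring_def)
    show "inv\<^bsub>add_monoid (coord_ring d)\<^esub> a \<in> I" if "a \<in> I" for a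
    proof -
      have "- a \<in> I" by (rule apoly.subspace_neg[OF assms(1) that])
      moreover have "inv\<^bsub>add_monoid (coord_ring d)\<^esub> a = - a"
        by (rule group.inv_equality) (use * that assms(2) \<open>- a \<in> I\<close> in auto)
      ultimately show ?thesis by simp
    qed
  qed (use assms apoly.subspace_0[OF assms(1)] apoly.subspace_add[OF assms(1)] in auto)
  fix a x assume ax: "a \<in> I" "x \<in> carrier (coord_ring d)"
  have "mon avar xs * a \<in> I" if "set xs \<subseteq> {..d}" for xs
    using that by (induction xs) (auto simp: mult.assoc intro: assms ax)
  moreover have "apoly.subspace {x. x * a \<in> I}"
    using subspace_mult_vimage[OF assms(1), of a] by (simp add: mult.commute)
  ultimately have "x * a \<in> I" using subspace_contains_coord_ring[of "{x. x * a \<in> I}"] ax by blast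
  then show "x \<otimes>\<^bsub>coord_ring d\<^esub> a \<in> I" "a \<otimes>\<^bsub>coord_ring d\<^esub> x \<in> I" by (simp_all add: mult.commute)
qed

lemma coord_ring_idealD:
  assumes "ideal I (coord_ring d)"
  shows "apoly.subspace I" "I \<subseteq> carrier (coord_ring d)"
    "f \<in> I \<Longrightarrow> g \<in> carrier (coord_ring d) \<Longrightarrow> g * f \<in> I"
proof -
  interpret ideal I "coord_ring d" by fact
  show 1: "f \<in> I \<Longrightarrow> g \<in> carrier (coord_ring d) \<Longrightarrow> g * f \<in> I" for f g
    using I_l_closed by simp
  show "apoly.subspace I"
  proof (rule apoly.subspaceI)
    show "0 \<in> I" using additive_subgroup.zero_closed[OF is_additive_subgroup] by simp
    show "x + y \<in> I" if "x \<in> I" "y \<in> I" for x y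
      using additive_subgroup.a_closed[OF is_additive_subgroup that] by simp
    show "const_poly c * x \<in> I" if "x \<in> I" for c x
      using 1[OF that coord_ring_const] .
  qed
  show "I \<subseteq> carrier (coord_ring d)" using a_subset .
qed

section \<open>Coefficients of the transvectants\<close>

text \<open>With the binomial coefficients split off, differentiation by x_1 keeps the sequence
  \<open>f\<close> and differentiation by x_2 shifts it, apart from a factor equal to the
  order.\<close>

definition bin_form :: "nat \<Rightarrow> (nat \<Rightarrow> apoly) \<Rightarrow> bform" where
  "bin_form N f = (\<Sum>k\<le>N. monom (monom (of_nat (N choose k) * f k) k) (N - k))"

lemma coeff_bin_form: "coeff (coeff (bin_form N f) i) j = (if i + j = N then of_nat (N choose j) * f j else 0)"
proof -
  have "coeff (coeff (bin_form N f) i) j = (\<Sum>k\<le>N. if k = j then (if i + j = N then of_nat (N choose j) * f j else 0) else 0)"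
    unfolding bin_form_def coeff_sum by (intro sum.cong) auto
  also have "\<dots> = (if i + j = N then of_nat (N choose j) * f j else 0)" by simp
  finally show ?thesis .
qed

lemma coeff_of_nat_mult: "coeff (of_nat n * p) i = of_nat n * coeff p i"
  by (simp add: of_nat_poly)

lemma generic_form_eq: "generic_form d = bin_form d avar"
proof -
  have x1: "form_x1 ^ n = monom 1 n" for n
    by (simp add: form_x1_def monom_altdef)
  have x2: "form_x2 ^ n = [:monom 1 n:]" for n
    by (induction n) (simp_all add: form_x2_def monom_Suc one_pCons mult.commute)
  have "of_nat c * scalar_form f * form_x1 ^ n * form_x2 ^ k = monom (monom (of_nat c * f) k) n" for c f n k
    by (simp add: x1 x2 scalar_form_def of_nat_poly smult_monom mult.commute[of _ "[:_:]"])
  then show ?thesis by (simp add: generic_form_def bin_form_def atLeast0AtMost)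
qed

lemma partial1_of_nat_mult: "partial1 (of_nat c * A) = of_nat c * partial1 A"
  by (simp add: partial1_def of_nat_poly pderiv_smult)

lemma coeff_partial1: "coeff (coeff (partial1 A) i) j = of_nat (Suc i) * coeff (coeff A (Suc i)) j"
  by (simp only: partial1_def coeff_pderiv coeff_of_nat_mult)

lemma coeff_partial2: "coeff (coeff (partial2 A) i) j = of_nat (Suc j) * coeff (coeff A i) (Suc j)"
  by (simp only: partial2_def coeff_map_poly[of pderiv, OF pderiv_0] coeff_pderiv)

lemma partial2_of_nat_mult: "partial2 (of_nat c * A) = of_nat c * partial2 A"
  by (intro poly_eqI) (simp only: coeff_partial2 coeff_of_nat_mult mult.left_commute)

lemma bform_eqI: "(\<And>i j. coeff (coeff A i) j = coeff (coeff B i) j) \<Longrightarrow> A = B" for A B :: bform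
  by (intro poly_eqI)

lemma partial1_bin_form: "partial1 (bin_form (Suc N) f) = of_nat (Suc N) * bin_form N f"
proof (rule bform_eqI)
  fix i j
  show "coeff (coeff (partial1 (bin_form (Suc N) f)) i) j = coeff (coeff (of_nat (Suc N) * bin_form N f) i) j"
  proof (cases "i + j = N")
    case True
    have "Suc i * (Suc N choose j) = Suc N * (N choose j)"
      using binomial_absorb_comp[of "Suc N" j] True by auto
    then have "of_nat (Suc i) * of_nat (Suc N choose j) = (of_nat (Suc N) * of_nat (N choose j) :: apoly)"
      by (simp only: of_nat_mult[symmetric])
    with True show ?thesis
      by (simp only: coeff_partial1 coeff_of_nat_mult coeff_bin_form mult.assoc[symmetric]) simp
  qed (simp add: coeff_partial1 coeff_of_nat_mult coeff_bin_form del: of_nat_Suc)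
qed

lemma partial2_bin_form: "partial2 (bin_form (Suc N) f) = of_nat (Suc N) * bin_form N (\<lambda>k. f (Suc k))"
proof (rule bform_eqI)
  fix i j
  show "coeff (coeff (partial2 (bin_form (Suc N) f)) i) j = coeff (coeff (of_nat (Suc N) * bin_form N (\<lambda>k. f (Suc k))) i) j"
  proof (cases "i + j = N")
    case True
    have "Suc j * (Suc N choose Suc j) = Suc N * (N choose j)"
      by (rule Suc_times_binomial)
    then have "of_nat (Suc j) * of_nat (Suc N choose Suc j) = (of_nat (Suc N) * of_nat (N choose j) :: apoly)"
      by (simp only: of_nat_mult[symmetric])
    with True show ?thesis
      by (simp only: coeff_partial2 coeff_of_nat_mult coeff_bin_form mult.assoc[symmetric]) simp
  qed (simp add: coeff_partial2 coeff_of_nat_mult coeff_bin_form del: of_nat_Suc)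
qed

lemma funpow_partial1_of_nat_mult: "(partial1 ^^ k) (of_nat c * A) = of_nat c * (partial1 ^^ k) A"
  by (induction k) (simp_all add: partial1_of_nat_mult)

lemma funpow_partial1_bin_form:
  "(partial1 ^^ k) (bin_form (N + k) f) = of_nat (\<Prod>j<k. N + k - j) * bin_form N f"
proof (induction k)
  case (Suc k)
  have "(partial1 ^^ Suc k) (bin_form (N + Suc k) f) = (partial1 ^^ k) (partial1 (bin_form (Suc (N + k)) f))"
    by (simp add: funpow_swap1)
  also have "\<dots> = of_nat (Suc (N + k) * (\<Prod>j<k. N + k - j)) * bin_form N f"
    unfolding partial1_bin_form funpow_partial1_of_nat_mult Suc of_nat_mult by (simp only: mult.assoc)
  also have "Suc (N + k) * (\<Prod>j<k. N + k - j) = (\<Prod>j<Suc k. N + Suc k - j)"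
    by (simp add: prod.lessThan_Suc_shift del: prod.lessThan_Suc)
  finally show ?case .
qed simp

lemma funpow_partial2_of_nat_mult: "(partial2 ^^ k) (of_nat c * A) = of_nat c * (partial2 ^^ k) A"
  by (induction k) (simp_all add: partial2_of_nat_mult)

lemma funpow_partial2_bin_form:
  "(partial2 ^^ k) (bin_form (N + k) f) = of_nat (\<Prod>j<k. N + k - j) * bin_form N (\<lambda>i. f (i + k))"
proof (induction k arbitrary: f)
  case (Suc k)
  have "(partial2 ^^ Suc k) (bin_form (N + Suc k) f) = (partial2 ^^ k) (partial2 (bin_form (Suc (N + k)) f))"
    by (simp add: funpow_swap1)
  also have "\<dots> = of_nat (Suc (N + k) * (\<Prod>j<k. N + k - j)) * bin_form N (\<lambda>i. f (Suc (i + k)))"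
    unfolding partial2_bin_form funpow_partial2_of_nat_mult Suc of_nat_mult by (simp only: mult.assoc)
  also have "Suc (N + k) * (\<Prod>j<k. N + k - j) = (\<Prod>j<Suc k. N + Suc k - j)"
    by (simp add: prod.lessThan_Suc_shift del: prod.lessThan_Suc)
  finally show ?case by simp
qed simp

lemma fact_prod_lessThan: "(\<Prod>j<k. N + k - j) * fact N = (fact (N + k) :: nat)"
proof (induction k)
  case (Suc k)
  have "(\<Prod>j<Suc k. N + Suc k - j) = Suc (N + k) * (\<Prod>j<k. N + k - j)"
    by (simp add: prod.lessThan_Suc_shift del: prod.lessThan_Suc)
  then have "(\<Prod>j<Suc k. N + Suc k - j) * fact N = Suc (N + k) * ((\<Prod>j<k. N + k - j) * fact N)"
    by (simp only: mult.assoc)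
  also have "\<dots> = fact (N + Suc k)" unfolding Suc by simp
  finally show ?case .
qed simp

text \<open>The r differentiations produce the factor d! / (d - r)!; its denominator is cleared so
  that the identity makes sense in the ring of forms.\<close>

lemma partials_generic_form:
  assumes "i + j = r" "r \<le> d"
  shows "of_nat (fact (d - r)) * (partial1 ^^ j) ((partial2 ^^ i) (generic_form d))
     = of_nat (fact d) * bin_form (d - r) (\<lambda>k. avar (k + i))"
proof -
  define N where "N = d - r"
  have d: "d = (N + j) + i" "d - r = N" using assms by (auto simp: N_def)
  have "(\<Prod>l<i. N + j + i - l) * ((\<Prod>l<j. N + j - l) * fact N) = (fact d :: nat)"
    unfolding fact_prod_lessThan d(1) ..
  then have "of_nat (fact N) * (of_nat (\<Prod>l<i. N + j + i - l) * of_nat (\<Prod>l<j. N + j - l)) = (of_nat (fact d) :: bform)"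
    by (simp only: of_nat_mult[symmetric] mult.commute mult.left_commute)
  then show ?thesis
    unfolding d(2) generic_form_eq
    unfolding d(1) funpow_partial2_bin_form funpow_partial1_of_nat_mult funpow_partial1_bin_form
    by (simp only: mult.assoc[symmetric])
qed

text \<open>The prefactor of the transvectant cancels exactly the factorials produced by the
  derivatives. The proof multiplies by both factorial products and cancels them at the end, since
  they are nonzero in an integral domain.\<close>

lemma HH_eq:
  assumes "r \<le> d"
  shows "HH d r = (\<Sum>i\<le>r. (- 1) ^ i * of_nat (r choose i) *
    (bin_form (d - r) (\<lambda>k. avar (k + i)) * bin_form (d - r) (\<lambda>k. avar (k + (r - i)))))"
proof -
  define F where "F = fact (d - r) * (fact (d - r) :: nat)"
  define D where "D = fact d * (fact d :: nat)"
  define P where "P i j = (partial1 ^^ j) ((partial2 ^^ i) (generic_form d))" for i j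
  define Q where "Q i = bin_form (d - r) (\<lambda>k. avar (k + i))" for i
  have "scalar_form (const_poly (fact (d - r) * fact (d - r) / (fact d * fact d))) * of_nat D
      = scalar_form (const_poly (fact (d - r) * fact (d - r) / (fact d * fact d)) * of_nat D)"
    by (simp add: scalar_form_def of_nat_poly mult.commute)
  also have "const_poly (fact (d - r) * fact (d - r) / (fact d * fact d)) * of_nat D = (of_nat F :: apoly)"
    unfolding const_poly_of_nat[symmetric] const_poly_mult[symmetric] by (simp add: F_def D_def)
  also have "scalar_form (of_nat F) = of_nat F"
    by (simp add: scalar_form_def of_nat_poly)
  finally have c: "scalar_form (const_poly (fact (d - r) * fact (d - r) / (fact d * fact d))) * of_nat D = (of_nat F :: bform)" .
  have F0: "(of_nat D :: bform) \<noteq> 0" "(of_nat F :: bform) \<noteq> 0" by (simp_all add: D_def F_def)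
  have summand: "of_nat F * (P i (r - i) * P (r - i) i) = of_nat D * (Q i * Q (r - i))" if "i \<le> r" for i
  proof -
    have "of_nat F * (P i (r - i) * P (r - i) i) = (of_nat (fact (d - r)) * P i (r - i)) * (of_nat (fact (d - r)) * P (r - i) i)"
      by (simp only: F_def of_nat_mult ac_simps)
    also have "\<dots> = (of_nat (fact d) * Q i) * (of_nat (fact d) * Q (r - i))"
      unfolding P_def Q_def using that assms by (simp only: partials_generic_form le_add_diff_inverse le_add_diff_inverse2)
    finally show ?thesis by (simp only: D_def of_nat_mult ac_simps)
  qed
  have "of_nat D * (of_nat F * HH d r) = of_nat F * (of_nat F * (\<Sum>i\<le>r. (- 1) ^ i * of_nat (r choose i) * P i (r - i) * P (r - i) i))"
  proof -
    have "of_nat D * (of_nat F * HH d r) = of_nat F *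
        ((scalar_form (const_poly (fact (d - r) * fact (d - r) / (fact d * fact d))) * of_nat D) *
          (\<Sum>i\<le>r. (- 1) ^ i * of_nat (r choose i) * P i (r - i) * P (r - i) i))"
      unfolding HH_def transvectant_def P_def atLeast0AtMost by (simp only: ac_simps)
    then show ?thesis unfolding c .
  qed
  also have "of_nat F * (\<Sum>i\<le>r. (- 1) ^ i * of_nat (r choose i) * P i (r - i) * P (r - i) i)
      = (\<Sum>i\<le>r. (- 1) ^ i * of_nat (r choose i) * (of_nat F * (P i (r - i) * P (r - i) i)))"
    by (simp only: sum_distrib_left ac_simps)
  also have "\<dots> = (\<Sum>i\<le>r. (- 1) ^ i * of_nat (r choose i) * (of_nat D * (Q i * Q (r - i))))"
    by (intro sum.cong refl) (simp only: summand atMost_iff)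
  also have "of_nat F * \<dots> = of_nat D * (of_nat F * (\<Sum>i\<le>r. (- 1) ^ i * of_nat (r choose i) * (Q i * Q (r - i))))"
    by (simp only: sum_distrib_left ac_simps)
  finally show ?thesis using F0 unfolding Q_def by (simp only: mult_cancel_left) simp
qed

lemma coeff_bin_form_mult:
  "coeff (coeff (bin_form N f * bin_form N g) i) j
     = (if i + j = 2 * N then \<Sum>k\<le>j. of_nat ((N choose k) * (N choose (j - k))) * (f k * g (j - k)) else 0)"
proof -
  have "coeff (coeff (bin_form N f * bin_form N g) i) j
      = (\<Sum>k\<le>j. \<Sum>u\<le>i. coeff (coeff (bin_form N f) u) k * coeff (coeff (bin_form N g) (i - u)) (j - k))"
    unfolding coeff_mult coeff_sum by (rule sum.swap)
  also have "\<dots> = (\<Sum>k\<le>j. if i + j = 2 * N then of_nat ((N choose k) * (N choose (j - k))) * (f k * g (j - k)) else 0)"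
  proof (rule sum.cong[OF refl])
    fix k assume k: "k \<in> {..j}"
    show "(\<Sum>u\<le>i. coeff (coeff (bin_form N f) u) k * coeff (coeff (bin_form N g) (i - u)) (j - k))
      = (if i + j = 2 * N then of_nat ((N choose k) * (N choose (j - k))) * (f k * g (j - k)) else 0)" (is "?L = ?R")
    proof (cases "i + j = 2 * N")
      case True
      \<comment> \<open>Once the exponent k of x_2 is fixed, homogeneity leaves at most one exponent
        u of x_1.\<close>
      have "?L = (\<Sum>u\<le>i. if u = N - k then (if k \<le> N then of_nat ((N choose k) * (N choose (j - k))) * (f k * g (j - k)) else 0) else 0)"
        unfolding coeff_bin_form using k True by (intro sum.cong refl) (auto simp: ac_simps)
      also have "\<dots> = ?R" using True by (auto simp: not_le)
      finally show ?thesis .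
    next
      case False
      have "?L = 0" unfolding coeff_bin_form using k False by (intro sum.neutral) auto
      then show ?thesis using False by simp
    qed
  qed
  also have "\<dots> = (if i + j = 2 * N then \<Sum>k\<le>j. of_nat ((N choose k) * (N choose (j - k))) * (f k * g (j - k)) else 0)"
    by simp
  finally show ?thesis .
qed

text \<open>The coefficient of x_1^(2(d-r)-n) x_2^n in (F, F)_r, as \<open>coeff_HH\<close> shows.
  For larger n the binomial coefficients make it vanish.\<close>

definition transv_coeff :: "nat \<Rightarrow> nat \<Rightarrow> nat \<Rightarrow> apoly" where
  "transv_coeff d r n = (\<Sum>i\<le>r. (- 1) ^ i * of_nat (r choose i) *
     (\<Sum>k\<le>n. of_nat ((d - r choose k) * (d - r choose (n - k))) * (avar (k + i) * avar (n - k + (r - i)))))"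

lemma coeff_HH:
  assumes "r \<le> d"
  shows "coeff (coeff (HH d r) i) j = (if i + j = 2 * (d - r) then transv_coeff d r j else 0)"
proof -
  have sgn: "coeff (coeff ((- 1) ^ l * of_nat c * A) i) j = (- 1) ^ l * of_nat c * coeff (coeff A i) j" for l c and A :: bform
    by (cases "even l") (simp_all add: coeff_of_nat_mult)
  show ?thesis
    unfolding HH_eq[OF assms] coeff_sum sgn coeff_bin_form_mult transv_coeff_def by (auto intro: sum.neutral)
qed

lemma bform_coeffs_HH:
  assumes "r \<le> d"
  shows "bform_coeffs (HH d r) \<subseteq> insert 0 (range (transv_coeff d r))"
    "n \<le> 2 * (d - r) \<Longrightarrow> transv_coeff d r n \<in> bform_coeffs (HH d r)"
proof -
  show "bform_coeffs (HH d r) \<subseteq> insert 0 (range (transv_coeff d r))"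
    by (auto simp: bform_coeffs_def coeff_HH[OF assms])
  assume n: "n \<le> 2 * (d - r)"
  then have "coeff (coeff (HH d r) (2 * (d - r) - n)) n = transv_coeff d r n"
    by (simp add: coeff_HH[OF assms])
  then show "transv_coeff d r n \<in> bform_coeffs (HH d r)"
    unfolding bform_coeffs_def by (intro CollectI exI conjI TrueI) (rule sym)
qed

lemma transv_coeff_2: "transv_coeff d 2 n = 2 * hess_gen avar d n"
proof -
  let ?C = "\<lambda>k. of_nat ((d - 2 choose k) * (d - 2 choose (n - k))) :: apoly"
  \<comment> \<open>The last of the three sums arising for r = 2 equals the first after reversing
    the order of summation, whence the factor 2.\<close>
  have "(\<Sum>k\<le>n. ?C k * (avar (k + 2) * avar (n - k))) = (\<Sum>k\<le>n. ?C (n - k) * (avar (n - k + 2) * avar (n - (n - k))))"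
    by (rule sum.nat_diff_reindex[symmetric, of _ "Suc n", simplified lessThan_Suc_atMost diff_Suc_Suc diff_Suc_1])
  also have "\<dots> = (\<Sum>k\<le>n. ?C k * (avar k * avar (n - k + 2)))"
    by (intro sum.cong refl) (simp add: ac_simps)
  finally have 2: "(\<Sum>k\<le>n. ?C k * (avar (k + 2) * avar (n - k))) = (\<Sum>k\<le>n. ?C k * (avar k * avar (n - k + 2)))" .
  have "transv_coeff d 2 n = (\<Sum>k\<le>n. ?C k * (avar k * avar (n - k + 2))) - 2 * (\<Sum>k\<le>n. ?C k * (avar (k + 1) * avar (n - k + 1)))
      + (\<Sum>k\<le>n. ?C k * (avar (k + 2) * avar (n - k)))"
    by (simp add: transv_coeff_def numeral_2_eq_2)
  then show ?thesis unfolding 2 by (simp add: hess_gen_def right_diff_distrib sum_subtractf)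
qed

text \<open>Variables of index above d occur formally, but only with a vanishing binomial
  coefficient.\<close>

lemma transv_coeff_carrier:
  assumes "r \<le> d"
  shows "transv_coeff d r n \<in> carrier (coord_ring d)"
proof -
  note sub = coord_ring_subspace[of d]
  have "of_nat ((d - r choose k) * (d - r choose (n - k))) * (avar (k + i) * avar (n - k + (r - i))) \<in> carrier (coord_ring d)"
    if "i \<le> r" for i k
  proof (cases "k \<le> d - r \<and> n - k \<le> d - r")
    case True
    then have "avar (k + i) * avar (n - k + (r - i)) \<in> carrier (coord_ring d)"
      using that assms by (intro coord_ring_mult coord_ring_avar) auto
    from apoly.subspace_scale[OF sub this, of "of_nat _"] show ?thesis by (simp only: const_poly_of_nat)
  next
    case False
    then have z: "(d - r choose k) * (d - r choose (n - k)) = 0" by (auto simp: not_le)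
    show ?thesis unfolding z using apoly.subspace_0[OF sub] by simp
  qed
  note summand = this
  have *: "(\<Sum>k\<le>n. of_nat ((d - r choose k) * (d - r choose (n - k))) * (avar (k + i) * avar (n - k + (r - i)))) \<in> carrier (coord_ring d)"
    if "i \<le> r" for i by (rule apoly.subspace_sum[OF sub]) (rule summand[OF that])
  show ?thesis unfolding transv_coeff_def
  proof (rule apoly.subspace_sum[OF sub])
    fix i assume "i \<in> {..r}"
    then have "const_poly ((- 1) ^ i * of_nat (r choose i)) * (\<Sum>k\<le>n. of_nat ((d - r choose k) * (d - r choose (n - k))) * (avar (k + i) * avar (n - k + (r - i)))) \<in> carrier (coord_ring d)"
      by (intro apoly.subspace_scale[OF sub] *) auto
    moreover have "const_poly ((- 1) ^ i * of_nat (r choose i)) = (- 1) ^ i * of_nat (r choose i)"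
      by (cases "even i") (simp_all add: const_poly_uminus)
    ultimately show "(- 1) ^ i * of_nat (r choose i) * (\<Sum>k\<le>n. of_nat ((d - r choose k) * (d - r choose (n - k))) * (avar (k + i) * avar (n - k + (r - i)))) \<in> carrier (coord_ring d)"
      by simp
  qed
qed

section \<open>The ideal of the Hessian\<close>

lemma hess_gen_restrict:
  "hess_gen a d n = (\<Sum>k\<in>{k. k \<le> n \<and> k \<le> d - 2 \<and> n - k \<le> d - 2}. of_nat ((d - 2 choose k) * (d - 2 choose (n - k))) *
     (a k * a (n - k + 2) - a (k + 1) * a (n - k + 1)))"
  unfolding hess_gen_def
  by (rule sum.mono_neutral_right) (auto simp: not_le)

text \<open>Reversing the variables turns weight n + 2 into 2 * d - (n + 2), and the symmetry of the
  binomial coefficients preserves the coefficients. This makes the same ideal available from both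
  ends of the curve.\<close>

lemma hess_gen_reverse:
  assumes "d \<ge> 2"
  shows "hess_gen (\<lambda>i. a (d - i)) d n = (if n \<le> 2 * (d - 2) then hess_gen a d (2 * (d - 2) - n) else 0)"
proof (cases "n \<le> 2 * (d - 2)")
  case True
  define m where "m = d - 2"
  have d: "d = m + 2" "d - 2 = m" using assms by (auto simp: m_def)
  have "hess_gen (\<lambda>i. a (d - i)) d n = hess_gen a d (2 * m - n)"
    unfolding hess_gen_restrict
  proof (rule sum.reindex_bij_witness[of _ "\<lambda>k. m - (2 * m - n - k)" "\<lambda>k. m - (n - k)"])
    fix k assume "k \<in> {k. k \<le> n \<and> k \<le> d - 2 \<and> n - k \<le> d - 2}"
    then have k: "k \<le> n" "k \<le> m" "n - k \<le> m" using d by auto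
    have *: "2 * m - n - (m - (n - k)) = m - k" using k by simp
    show "m - (2 * m - n - (m - (n - k))) = k" "m - (n - k) \<in> {k. k \<le> 2 * m - n \<and> k \<le> d - 2 \<and> 2 * m - n - k \<le> d - 2}"
      using k d by auto
    have sym: "(m choose (m - (n - k))) = (m choose (n - k))" "(m choose (m - k)) = (m choose k)"
      using k binomial_symmetric[of "n - k" m] binomial_symmetric[of k m] by simp_all
    have idx: "d - k = m - k + 2" "d - (n - k + 2) = m - (n - k)" "d - (k + 1) = m - k + 1" "d - (n - k + 1) = m - (n - k) + 1"
      using k d by auto
    show "of_nat ((d - 2 choose (m - (n - k))) * (d - 2 choose (2 * m - n - (m - (n - k))))) *
        (a (m - (n - k)) * a (2 * m - n - (m - (n - k)) + 2) - a (m - (n - k) + 1) * a (2 * m - n - (m - (n - k)) + 1))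
      = of_nat ((d - 2 choose k) * (d - 2 choose (n - k))) * (a (d - k) * a (d - (n - k + 2)) - a (d - (k + 1)) * a (d - (n - k + 1)))"
      unfolding * idx d(2) sym by (simp add: mult.commute)
  next
    fix k assume "k \<in> {k. k \<le> 2 * m - n \<and> k \<le> d - 2 \<and> 2 * m - n - k \<le> d - 2}"
    then show "m - (n - (m - (2 * m - n - k))) = k" "m - (2 * m - n - k) \<in> {k. k \<le> n \<and> k \<le> d - 2 \<and> n - k \<le> d - 2}"
      using d True by auto
  qed
  then show ?thesis using True d by simp
next
  case False
  then have "{k. k \<le> n \<and> k \<le> d - 2 \<and> n - k \<le> d - 2} = {}" by auto
  with False show ?thesis by (simp only: hess_gen_restrict) simp
qed

lemma derivation_of_nat_mult: "derivation h (of_nat n * f) = of_nat n * derivation h f"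
  using derivation_scale[of h "of_nat n" f] by simp

lemma derivation_uminus: "derivation h (- f) = - derivation h f"
  using derivation_scale[of h "- 1" f] by (simp add: const_poly_uminus)

lemma derivation_diff: "derivation h (f - g) = derivation h f - derivation h g"
  using derivation_add[of h f "- g"] by (simp add: derivation_uminus)

lemma derivation_sum: "derivation h (\<Sum>i\<in>A. f i) = (\<Sum>i\<in>A. derivation h (f i))"
  by (induction A rule: infinite_finite_induct) (simp_all add: derivation_add derivation_zero)

text \<open>The Hessian is a covariant, so the raising operator moves each of its coefficients to a
  multiple of the next. By binomial absorption the two index shifts contribute n + 1 - k and k times
  the k-th term.\<close>

lemma derivation_hess_gen:
  assumes "d \<ge> 2" and h: "\<And>i. i \<le> d \<Longrightarrow> derivation h (a i) = of_nat (d - i) * a (Suc i)"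
  shows "derivation h (hess_gen a d n) = of_nat (Suc n) * hess_gen a d (Suc n)"
proof -
  define m where "m = d - 2"
  have d: "d = m + 2" using assms by (simp add: m_def)
  define C where "C k = (m choose k)" for k
  define B where "B k l = a k * a (l + 2) - a (k + 1) * a (l + 1)" for k l
  have gen: "hess_gen a d n = (\<Sum>k\<le>n. of_nat (C k * C (n - k)) * B k (n - k))" for n
    by (simp add: hess_gen_def C_def B_def m_def)
  have summand: "of_nat (C k * C l) * derivation h (B k l)
      = of_nat (C k * (Suc l * C (Suc l))) * B k (Suc l) + of_nat (Suc k * C (Suc k) * C l) * B (Suc k) l
        + of_nat (C k * C l) * B (Suc k) l" for k l
  proof (cases "k \<le> m \<and> l \<le> m")
    case True
    have "derivation h (B k l) = (of_nat (d - k) * a (Suc k)) * a (l + 2) + a k * (of_nat (d - (l + 2)) * a (Suc (l + 2)))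
       - ((of_nat (d - (k + 1)) * a (Suc (k + 1))) * a (l + 1) + a (k + 1) * (of_nat (d - (l + 1)) * a (Suc (l + 1))))"
    proof -
      have "k \<le> d" "l + 2 \<le> d" "k + 1 \<le> d" "l + 1 \<le> d" using True d by auto
      then show ?thesis by (simp only: B_def derivation_diff derivation_mult h)
    qed
    also have "\<dots> = of_nat (m - l) * B k (Suc l) + of_nat (m - k) * B (Suc k) l + B (Suc k) l"
    proof -
      have "d - k = (m - k) + 2" "d - (l + 2) = m - l" "d - (k + 1) = (m - k) + 1" "d - (l + 1) = (m - l) + 1"
        using True d by auto
      then show ?thesis by (simp add: B_def algebra_simps)
    qed
    finally have *: "derivation h (B k l) = of_nat (m - l) * B k (Suc l) + of_nat (m - k) * B (Suc k) l + B (Suc k) l" .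
    have "Suc l * C (Suc l) = (m - l) * C l" "Suc k * C (Suc k) = (m - k) * C k"
      unfolding C_def by (rule binomial_Suc_step)+
    then show ?thesis unfolding * by (simp only: of_nat_mult distrib_left ac_simps)
  next
    case False
    then have "C k = 0 \<and> C (Suc k) = 0 \<or> C l = 0 \<and> C (Suc l) = 0" by (auto simp: C_def not_le)
    then show ?thesis by auto
  qed
  define T where "T k = of_nat (C k * C (Suc n - k)) * B k (Suc n - k)" for k
  have "derivation h (hess_gen a d n) = (\<Sum>k\<le>n. of_nat (C k * (Suc (n - k) * C (Suc (n - k)))) * B k (Suc (n - k)))
      + (\<Sum>k\<le>n. of_nat (Suc k * C (Suc k) * C (n - k)) * B (Suc k) (n - k)) + (\<Sum>k\<le>n. of_nat (C k * C (n - k)) * B (Suc k) (n - k))"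
    unfolding gen derivation_sum derivation_of_nat_mult summand sum.distrib ..
  \<comment> \<open>\<open>B (Suc k) l\<close> changes sign when k and l are exchanged, while the
    binomial factors are symmetric.\<close>
  also have "(\<Sum>k\<le>n. of_nat (C k * C (n - k)) * B (Suc k) (n - k)) = 0"
  proof -
    have "(\<Sum>k\<le>n. of_nat (C k * C (n - k)) * (a (Suc k) * a (n - k + 2))) = (\<Sum>k\<le>n. of_nat (C (n - k) * C (n - (n - k))) * (a (Suc (n - k)) * a (n - (n - k) + 2)))"
      by (rule sum.nat_diff_reindex[symmetric, of _ "Suc n", simplified lessThan_Suc_atMost diff_Suc_Suc diff_Suc_1])
    also have "\<dots> = (\<Sum>k\<le>n. of_nat (C k * C (n - k)) * (a (Suc k + 1) * a (n - k + 1)))"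
      by (intro sum.cong refl) (simp add: ac_simps)
    finally show ?thesis by (simp only: B_def right_diff_distrib sum_subtractf diff_self)
  qed
  also have "(\<Sum>k\<le>n. of_nat (C k * (Suc (n - k) * C (Suc (n - k)))) * B k (Suc (n - k))) = (\<Sum>k\<le>n. of_nat (Suc n - k) * T k)"
    by (intro sum.cong refl) (simp only: T_def atMost_iff Suc_diff_le of_nat_mult ac_simps)
  also have "\<dots> = (\<Sum>k\<le>Suc n. of_nat (Suc n - k) * T k)" by simp
  also have "(\<Sum>k\<le>n. of_nat (Suc k * C (Suc k) * C (n - k)) * B (Suc k) (n - k)) = (\<Sum>k\<le>n. of_nat (Suc k) * T (Suc k))"
    by (intro sum.cong refl) (simp only: T_def diff_Suc_Suc of_nat_mult ac_simps)
  also have "\<dots> = (\<Sum>k\<le>Suc n. of_nat k * T k)" unfolding sum.atMost_Suc_shift by simp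
  also have "(\<Sum>k\<le>Suc n. of_nat (Suc n - k) * T k) + (\<Sum>k\<le>Suc n. of_nat k * T k) + 0 = (\<Sum>k\<le>Suc n. of_nat (Suc n - k) * T k + of_nat k * T k)"
    by (simp only: sum.distrib add_0_right)
  also have "\<dots> = (\<Sum>k\<le>Suc n. of_nat (Suc n) * T k)"
    by (intro sum.cong refl) (simp only: atMost_iff distrib_right[symmetric] of_nat_add[symmetric] le_add_diff_inverse2)
  also have "\<dots> = of_nat (Suc n) * hess_gen a d (Suc n)"
    by (simp only: gen T_def sum_distrib_left)
  finally show ?thesis .
qed

lemma hess_gen_carrier: "d \<ge> 2 \<Longrightarrow> hess_gen avar d n \<in> carrier (coord_ring d)"
proof (rule subspace_of_nat_cancel[OF coord_ring_subspace])
  assume "d \<ge> 2"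
  then show "of_nat 2 * hess_gen avar d n \<in> carrier (coord_ring d)"
    using transv_coeff_carrier[of 2 d n] by (simp add: transv_coeff_2)
qed simp

section \<open>The ideal of the Hessian as a linear span, and the operators acting on it\<close>

context
  fixes d :: nat
  assumes d2: "d \<ge> 2"
begin

lemma JJ_gens_carrier: "k \<le> d \<Longrightarrow> (\<Union>q \<in> {q. 1 \<le> q \<and> 2 * q \<le> k}. bform_coeffs (HH d (2 * q))) \<subseteq> carrier (coord_ring d)"
  using bform_coeffs_HH(1) transv_coeff_carrier apoly.subspace_0[OF coord_ring_subspace]
  by (fastforce dest!: subsetD[OF bform_coeffs_HH(1), rotated])

lemma JJ_ideal: "k \<le> d \<Longrightarrow> ideal (JJ d k) (coord_ring d)"
  unfolding JJ_def
  by (intro ring.genideal_ideal JJ_gens_carrier) (use coord_ring_cring cring_def in auto)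

lemma JJ_gen_mem:
  assumes "k \<le> d" "1 \<le> q" "2 * q \<le> k" "n \<le> 2 * (d - 2 * q)"
  shows "transv_coeff d (2 * q) n \<in> JJ d k"
proof -
  have "transv_coeff d (2 * q) n \<in> bform_coeffs (HH d (2 * q))"
    using assms by (intro bform_coeffs_HH(2)) auto
  then have "transv_coeff d (2 * q) n \<in> (\<Union>q \<in> {q. 1 \<le> q \<and> 2 * q \<le> k}. bform_coeffs (HH d (2 * q)))"
    using assms by blast
  then show ?thesis unfolding JJ_def
    using ring.genideal_self[OF _ JJ_gens_carrier[OF assms(1)]] coord_ring_cring cring_def by blast
qed

lemma JJ_minimal:
  assumes "k \<le> d" "ideal I (coord_ring d)"
    and "\<And>q n. 1 \<le> q \<Longrightarrow> 2 * q \<le> k \<Longrightarrow> transv_coeff d (2 * q) n \<in> I"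
  shows "JJ d k \<subseteq> I"
  unfolding JJ_def
proof (rule ring.genideal_minimal[OF _ assms(2)])
  show "ring (coord_ring d)" using coord_ring_cring cring_def by blast
  show "(\<Union>q \<in> {q. 1 \<le> q \<and> 2 * q \<le> k}. bform_coeffs (HH d (2 * q))) \<subseteq> I"
  proof safe
    fix q f assume q: "1 \<le> q" "2 * q \<le> k" and f: "f \<in> bform_coeffs (HH d (2 * q))"
    have "f = 0 \<or> (\<exists>n. f = transv_coeff d (2 * q) n)"
      using f bform_coeffs_HH(1)[of "2 * q" d] q assms(1) by auto
    then show "f \<in> I" using assms(3)[OF q] apoly.subspace_0[OF coord_ring_idealD(1)[OF assms(2)]] by auto
  qed
qed

lemma JJ_mono:
  assumes "k \<le> l" "l \<le> d"
  shows "JJ d k \<subseteq> JJ d l"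
  unfolding JJ_def
  by (rule ring.subset_Idl_subset) (use assms JJ_gens_carrier[of l] coord_ring_cring cring_def in \<open>auto simp: subset_iff\<close>)

text \<open>A description of \<open>JJ d 2\<close> by a spanning set, see \<open>JJ_2_eq\<close>;
  both the stability under derivations and the dimension count start from it.\<close>

definition hess_span :: "apoly set" where
  "hess_span = apoly.span {mon avar xs * hess_gen avar d n | xs n. set xs \<subseteq> {..d} \<and> n \<le> 2 * (d - 2)}"

lemma hess_gen_big: "n > 2 * (d - 2) \<Longrightarrow> hess_gen a d n = 0"
proof -
  assume "n > 2 * (d - 2)"
  then have "{k. k \<le> n \<and> k \<le> d - 2 \<and> n - k \<le> d - 2} = {}" by auto
  then show ?thesis by (simp only: hess_gen_restrict) simp
qed

lemma hess_span_gen: "set xs \<subseteq> {..d} \<Longrightarrow> mon avar xs * hess_gen avar d n \<in> hess_span"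
proof (cases "n \<le> 2 * (d - 2)")
  case True
  then show "set xs \<subseteq> {..d} \<Longrightarrow> mon avar xs * hess_gen avar d n \<in> hess_span"
    unfolding hess_span_def by (intro apoly.span_base) blast
next
  case False
  then show ?thesis by (simp add: hess_gen_big hess_span_def apoly.span_zero)
qed

lemma hess_span_subspace: "apoly.subspace hess_span"
  by (simp add: hess_span_def)

lemma JJ_2_eq: "JJ d 2 = hess_span"
proof
  have "ideal hess_span (coord_ring d)"
  proof (rule coord_ring_idealI[OF hess_span_subspace])
    show "hess_span \<subseteq> carrier (coord_ring d)"
      unfolding hess_span_def
      by (rule apoly.span_minimal[OF _ coord_ring_subspace]) (use d2 in \<open>auto intro!: coord_ring_mult coord_ring_mon hess_gen_carrier\<close>)
    fix i f assume i: "i \<le> d" and "f \<in> hess_span"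
    have "hess_span \<subseteq> {f. avar i * f \<in> hess_span}"
      unfolding hess_span_def
    proof (rule apoly.span_minimal[OF _ subspace_mult_vimage], fold hess_span_def)
      show "{mon avar xs * hess_gen avar d n | xs n. set xs \<subseteq> {..d} \<and> n \<le> 2 * (d - 2)} \<subseteq> {f. avar i * f \<in> hess_span}"
      proof clarify
        fix xs n assume "set xs \<subseteq> {..d}"
        then show "avar i * (mon avar xs * hess_gen avar d n) \<in> hess_span"
          using hess_span_gen[of "i # xs" n] i by (simp add: mult.assoc)
      qed
    qed (rule hess_span_subspace)
    then show "avar i * f \<in> hess_span" using \<open>f \<in> hess_span\<close> by blast
  qed
  then show "JJ d 2 \<subseteq> hess_span"
  proof (rule JJ_minimal[OF d2])
    fix q n assume "1 \<le> q" "2 * q \<le> (2 :: nat)"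
    then have "q = 1" by simp
    then show "transv_coeff d (2 * q) n \<in> hess_span"
      using apoly.subspace_scale[OF hess_span_subspace hess_span_gen[of "[]" n], of "of_nat 2"]
      unfolding const_poly_of_nat by (simp add: transv_coeff_2)
  qed
  show "hess_span \<subseteq> JJ d 2"
    unfolding hess_span_def
  proof (rule apoly.span_minimal)
    note I = coord_ring_idealD[OF JJ_ideal[OF d2]]
    show "apoly.subspace (JJ d 2)" by (rule I(1))
    show "{mon avar xs * hess_gen avar d n | xs n. set xs \<subseteq> {..d} \<and> n \<le> 2 * (d - 2)} \<subseteq> JJ d 2"
    proof clarify
      fix xs n assume "set xs \<subseteq> {..d}" "n \<le> 2 * (d - 2)"
      moreover have "hess_gen avar d n \<in> JJ d 2"
        using JJ_gen_mem[OF d2, of 1 n] \<open>n \<le> _\<close> subspace_of_nat_cancel[OF I(1), of 2 "hess_gen avar d n"]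
        by (simp add: transv_coeff_2)
      ultimately show "mon avar xs * hess_gen avar d n \<in> JJ d 2"
        using I(3) coord_ring_mon by blast
    qed
  qed
qed

text \<open>By the Leibniz rule only the images of the generators matter once the derivation maps
  the coordinate ring into itself.\<close>

lemma derivation_hess_span:
  assumes h: "\<And>i. i \<le> d \<Longrightarrow> h i \<in> carrier (coord_ring d)"
    and gen: "\<And>n. derivation h (hess_gen avar d n) \<in> hess_span"
    and f: "f \<in> hess_span"
  shows "derivation h f \<in> hess_span"
proof -
  have I: "ideal hess_span (coord_ring d)" using JJ_ideal[OF d2] JJ_2_eq by simp
  have car: "derivation h (mon avar xs) \<in> carrier (coord_ring d)" if "set xs \<subseteq> {..d}" for xs
    using that
  proof (induction xs)
    case Nil
    then show ?case using derivation_mult[of h 1 1] apoly.subspace_0[OF coord_ring_subspace] by simp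
  next
    case (Cons x xs)
    then show ?case
      by (auto simp: derivation_mult intro!: apoly.subspace_add[OF coord_ring_subspace] coord_ring_mult h coord_ring_mon coord_ring_avar)
  qed
  have "hess_span \<subseteq> {f. derivation h f \<in> hess_span}"
    unfolding hess_span_def
  proof (rule apoly.span_minimal, fold hess_span_def)
    show "apoly.subspace {f. derivation h f \<in> hess_span}"
      unfolding derivation_def by (rule subspace_lin_ext_vimage[OF hess_span_subspace])
    show "{mon avar xs * hess_gen avar d n | xs n. set xs \<subseteq> {..d} \<and> n \<le> 2 * (d - 2)} \<subseteq> {f. derivation h f \<in> hess_span}"
    proof clarify
      fix xs n assume xs: "set xs \<subseteq> {..d}"
      have "hess_gen avar d n \<in> hess_span" using hess_span_gen[of "[]" n] by simp
      then show "derivation h (mon avar xs * hess_gen avar d n) \<in> hess_span"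
        unfolding derivation_mult
        using coord_ring_idealD(3)[OF I] car[OF xs] gen[of n] coord_ring_mon[OF xs]
        by (intro apoly.subspace_add[OF hess_span_subspace]) auto
    qed
  qed
  with f show ?thesis by blast
qed

text \<open>\<open>raise\<close> and \<open>lower\<close> are the raising and lowering operators of
  the action of sl_2 on binary forms. The truncated differences are harmless: the coefficient d - i
  or i is 0 where an index would leave the range.\<close>

definition raise :: "apoly \<Rightarrow> apoly" where
  "raise = derivation (\<lambda>i. of_nat (d - i) * avar (Suc i))"

definition lower :: "apoly \<Rightarrow> apoly" where
  "lower = derivation (\<lambda>i. of_nat i * avar (i - 1))"

lemma raise_add: "raise (f + g) = raise f + raise g"
  and raise_scale: "raise (const_poly c * f) = const_poly c * raise f"
  and raise_mult: "raise (f * g) = raise f * g + f * raise g"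
  and lower_add: "lower (f + g) = lower f + lower g"
  and lower_scale: "lower (const_poly c * f) = const_poly c * lower f"
  and lower_mult: "lower (f * g) = lower f * g + f * lower g"
  unfolding raise_def lower_def by (rule derivation_add derivation_scale derivation_mult)+

lemma hess_span_of_nat: "f \<in> hess_span \<Longrightarrow> of_nat n * f \<in> hess_span"
  using apoly.subspace_scale[OF hess_span_subspace, of f "of_nat n"] by simp

lemma coord_ring_of_nat: "f \<in> carrier (coord_ring d) \<Longrightarrow> of_nat n * f \<in> carrier (coord_ring d)"
  using apoly.subspace_scale[OF coord_ring_subspace, of f d "of_nat n"] by simp

lemma raise_hess_span: "f \<in> hess_span \<Longrightarrow> raise f \<in> hess_span"
  unfolding raise_def
proof (rule derivation_hess_span)
  fix n
  have "derivation (\<lambda>i. of_nat (d - i) * avar (Suc i)) (hess_gen avar d n) = of_nat (Suc n) * hess_gen avar d (Suc n)"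
    by (rule derivation_hess_gen[OF d2]) simp
  then show "derivation (\<lambda>i. of_nat (d - i) * avar (Suc i)) (hess_gen avar d n) \<in> hess_span"
    using hess_span_of_nat[OF hess_span_gen[of "[]"], of "Suc n"] by simp
next
  fix i assume "i \<le> d"
  then show "of_nat (d - i) * avar (Suc i) \<in> carrier (coord_ring d)"
  proof (cases "i = d")
    case True
    then show ?thesis using apoly.subspace_0[OF coord_ring_subspace] by simp
  next
    case False
    with \<open>i \<le> d\<close> have "Suc i \<le> d" by simp
    then show ?thesis by (rule coord_ring_of_nat[OF coord_ring_avar])
  qed
qed

lemma lower_avar_reverse: "i \<le> d \<Longrightarrow> lower (avar (d - i)) = of_nat (d - i) * avar (d - Suc i)"
  by (simp add: lower_def)

text \<open>In the reversed variables \<open>lower\<close> has the shape treated in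
  \<open>derivation_hess_gen\<close>, and \<open>hess_gen_reverse\<close> translates the result
  back.\<close>

lemma lower_hess_span: "f \<in> hess_span \<Longrightarrow> lower f \<in> hess_span"
  unfolding lower_def
proof (rule derivation_hess_span)
  fix n
  show "derivation (\<lambda>i. of_nat i * avar (i - 1)) (hess_gen avar d n) \<in> hess_span"
  proof (cases "n \<le> 2 * (d - 2)")
    case True
    have "derivation (\<lambda>i. of_nat i * avar (i - 1)) (hess_gen (\<lambda>i. avar (d - i)) d (2 * (d - 2) - n))
        = of_nat (Suc (2 * (d - 2) - n)) * hess_gen (\<lambda>i. avar (d - i)) d (Suc (2 * (d - 2) - n))"
      by (rule derivation_hess_gen[OF d2]) simp
    then have *: "derivation (\<lambda>i. of_nat i * avar (i - 1)) (hess_gen avar d n)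
        = of_nat (Suc (2 * (d - 2) - n)) * hess_gen (\<lambda>i. avar (d - i)) d (Suc (2 * (d - 2) - n))"
      using True by (simp add: hess_gen_reverse[OF d2] del: of_nat_Suc)
    show ?thesis unfolding * hess_gen_reverse[OF d2]
      using hess_span_gen[of "[]"] apoly.subspace_0[OF hess_span_subspace]
      by (intro hess_span_of_nat) auto
  next
    case False
    then show ?thesis using apoly.subspace_0[OF hess_span_subspace]
      by (simp add: hess_gen_big derivation_zero)
  qed
next
  fix i assume "i \<le> d"
  then show "of_nat i * avar (i - 1) \<in> carrier (coord_ring d)"
    by (auto intro!: coord_ring_of_nat coord_ring_avar)
qed

lemma hess_pair_coord: "hess_pair d avar hess_span raise lower"
proof -
  have mult: "avar i * f \<in> hess_span" if "i \<le> d" "f \<in> hess_span" for i f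
    using coord_ring_idealD(3)[OF JJ_ideal[OF d2], unfolded JJ_2_eq] that coord_ring_avar by blast
  have gen: "hess_gen avar d n \<in> hess_span" for n using hess_span_gen[of "[]" n] by simp
  have "hess_ideal d avar hess_span raise"
  proof
    show "raise (avar i) = of_nat (d - i) * avar (Suc i)" if "i \<le> d" for i by (simp add: raise_def)
  qed (rule d2 hess_span_subspace mult gen raise_hess_span raise_add raise_scale raise_mult; assumption)+
  moreover have "hess_ideal d (\<lambda>i. avar (d - i)) hess_span lower"
  proof
    show "hess_gen (\<lambda>i. avar (d - i)) d n \<in> hess_span" for n
      using gen apoly.subspace_0[OF hess_span_subspace] by (simp add: hess_gen_reverse[OF d2])
    show "avar (d - i) * f \<in> hess_span" if "i \<le> d" "f \<in> hess_span" for i f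
      using mult[of "d - i"] that by simp
  qed (rule d2 hess_span_subspace lower_avar_reverse lower_hess_span lower_add lower_scale lower_mult; assumption)+
  ultimately show ?thesis by (simp add: hess_pair_def)
qed

end

section \<open>Restriction to the rational normal curve\<close>

text \<open>The restriction to the rational normal curve \<open>a\<^sub>i = y\<^sup>i\<close>; the variable of index 0 plays the
  role of \<open>y\<close>.\<close>

definition curve_var :: "nat \<Rightarrow> apoly" where
  "curve_var v = mterm (Poly_Mapping.single 0 v)"

definition curve :: "apoly \<Rightarrow> apoly" where
  "curve = lin_ext (\<lambda>m. curve_var (weight m))"

lemma curve_var_mult: "curve_var v * curve_var w = curve_var (v + w)"
  by (simp add: curve_var_def mterm_add[symmetric] single_add)

lemma curve_add: "curve (f + g) = curve f + curve g"
  and curve_scale: "curve (const_poly c * f) = const_poly c * curve f"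
  and curve_mterm: "curve (mterm m) = curve_var (weight m)"
  and curve_zero: "curve 0 = 0"
  by (simp_all add: curve_def lin_ext_add lin_ext_scale)

lemma curve_avar: "curve (avar i) = curve_var i"
  by (simp add: avar_mterm curve_mterm)

lemma curve_mult: "curve (f * g) = curve f * curve g"
proof -
  have 1: "curve (mterm m * g) = curve (mterm m) * curve g" for m
  proof -
    have "apoly.subspace {g. curve (mterm m * g) = curve (mterm m) * curve g}"
      by (rule apoly.subspaceI)
        (simp_all add: curve_add curve_scale curve_zero distrib_left mult.left_commute[of "mterm m"] mult.left_commute[of "curve (mterm m)"])
    from subspace_all_mterms[OF this] show ?thesis
      by (auto simp: mterm_add[symmetric] curve_mterm weight_add curve_var_mult)
  qed
  have "apoly.subspace {f. curve (f * g) = curve f * curve g}"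
    by (rule apoly.subspaceI) (simp_all add: curve_add curve_scale curve_zero distrib_right mult.assoc)
  from subspace_all_mterms[OF this] show ?thesis using 1 by blast
qed

lemma curve_of_nat: "curve (of_nat n * f) = of_nat n * curve f"
  using curve_scale[of "of_nat n" f] by simp

lemma curve_sum: "curve (\<Sum>i\<in>A. f i) = (\<Sum>i\<in>A. curve (f i))"
  by (induction A rule: infinite_finite_induct) (simp_all add: curve_add curve_zero)

lemma curve_mon: "curve (mon avar xs) = curve_var (sum_list xs)"
proof (induction xs)
  case Nil
  then show ?case using curve_mterm[of 0] by simp
qed (simp add: curve_mult curve_avar curve_var_mult)

lemma curve_comb: "comb avar d r v f s \<Longrightarrow> curve f = const_poly s * curve_var v"
  by (induction rule: comb.induct)
    (simp_all add: curve_zero curve_add curve_scale curve_mon const_poly_add distrib_right)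

text \<open>On the curve all products involved take the same value y^(n + r), so the alternating sum
  of binomial coefficients splits off, and it vanishes for r >= 1.\<close>

lemma curve_transv_coeff:
  assumes "r \<ge> 1"
  shows "curve (transv_coeff d r n) = 0"
proof -
  have sgn: "curve ((- 1) ^ i * of_nat c * f) = (- 1) ^ i * of_nat c * curve f" for i c f
    using curve_scale[of "(- 1) ^ i * of_nat c" f]
    by (cases "even i") (simp_all add: const_poly_uminus)
  define S where "S = (\<Sum>k\<le>n. of_nat ((d - r choose k) * (d - r choose (n - k))) * curve_var (n + r))"
  have "curve (transv_coeff d r n) = (\<Sum>i\<le>r. (- 1) ^ i * of_nat (r choose i) * S)"
    unfolding transv_coeff_def curve_sum sgn unfolding curve_of_nat
    unfolding curve_mult curve_avar curve_var_mult S_def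
    by (intro sum.cong refl arg_cong2[of _ _ _ _ "(*)"] arg_cong[of _ _ curve_var]) auto
  also have "\<dots> = (\<Sum>i\<le>r. (- 1) ^ i * of_nat (r choose i)) * S"
    by (rule sum_distrib_right[symmetric])
  also have "\<dots> = 0" using choose_alternating_sum[of r, where 'a = apoly] assms by simp
  finally show ?thesis .
qed

lemma curve_JJ:
  assumes "d \<ge> 2" "k \<le> d" "f \<in> JJ d k"
  shows "curve f = 0"
proof -
  have "ideal {f \<in> carrier (coord_ring d). curve f = 0} (coord_ring d)"
  proof (rule coord_ring_idealI)
    show "apoly.subspace {f \<in> carrier (coord_ring d). curve f = 0}"
      using apoly.subspace_0[OF coord_ring_subspace] apoly.subspace_add[OF coord_ring_subspace] apoly.subspace_scale[OF coord_ring_subspace]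
      by (intro apoly.subspaceI) (auto simp: curve_zero curve_add curve_scale)
  qed (auto simp: curve_mult intro: coord_ring_mult coord_ring_avar)
  then have "JJ d k \<subseteq> {f \<in> carrier (coord_ring d). curve f = 0}"
    using assms by (intro JJ_minimal) (auto intro!: transv_coeff_carrier curve_transv_coeff)
  with assms show ?thesis by blast
qed

section \<open>Collapse of the chain of ideals in degrees at least d + 2\<close>

theorem graded_JJ_subset:
  assumes d: "d \<ge> 2" and t: "t \<ge> d + 2" and k: "k \<le> d"
    and f: "f \<in> graded_piece (JJ d k) t"
  shows "f \<in> JJ d 2"
proof -
  interpret hess_pair d avar "hess_span d" "raise d" lower
    by (rule hess_pair_coord[OF d])
  define e where "e v = (raise d ^^ v) (avar 0 ^ t)" for v
  define B where "B = apoly.span (hess_span d \<union> range e)"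
  have e: "comb avar d t v (e v) (of_nat (\<Prod>j<v. d * t - j))" for v
    using fwd.comb_E_pow[OF comb_pow[of 0 d avar t], of v] by (simp add: e_def)
  have eE: "raise d (e v) = e (Suc v)" for v by (simp add: e_def)
  have B: "apoly.subspace B" "hess_span d \<subseteq> B" "e v \<in> B" for v
    by (auto simp: B_def intro: apoly.span_base)
  have "B \<subseteq> {f. raise d f \<in> B}" unfolding B_def
  proof (rule apoly.span_minimal, fold B_def)
    show "apoly.subspace {f. raise d f \<in> B}"
      using apoly.subspace_0[OF B(1)] apoly.subspace_add[OF B(1)] apoly.subspace_scale[OF B(1)]
      by (intro apoly.subspaceI) (auto simp: fwd.E_zero fwd.E_add fwd.E_scale)
    show "hess_span d \<union> range e \<subseteq> {f. raise d f \<in> B}"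
      using fwd.E_J B(2,3) by (auto simp: eE)
  qed
  then have stable: "raise d f \<in> B" if "f \<in> B" for f using that by blast
  have mon: "mon avar xs \<in> B" if "set xs \<subseteq> {..d}" "length xs = t" for xs
    using comb_in_stable_subspace[OF B(1,2) stable B(3)[unfolded e_def] t comb_mon[OF that refl]] .
  have car: "f \<in> carrier (coord_ring d)" and deg: "m \<in> Poly_Mapping.keys f \<Longrightarrow> mono_degree m = t" for m
    using f coord_ring_idealD(2)[OF JJ_ideal[OF d k]] by (auto simp: graded_piece_def)
  have "f \<in> B"
  proof (rule subspace_all_mterms[OF B(1)])
    fix m assume m: "m \<in> Poly_Mapping.keys f"
    then have "Poly_Mapping.keys m \<subseteq> {..d}" using car by (auto simp: carrier_coord_ring)
    then show "mterm m \<in> B"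
      by (rule mterm_eq_mon) (use mon deg[OF m] in auto)
  qed
  \<comment> \<open>The part j vanishes on the curve, hence so does g. It remains to see that
    \<open>curve\<close> is injective on the span of the \<open>e v\<close>.\<close>
  then obtain j g where jg: "f = j + g" "j \<in> hess_span d" "g \<in> apoly.span (range e)"
    unfolding B_def apoly.span_Un using apoly.span_eq_iff[THEN iffD2, OF hess_span_subspace[OF d]] by auto
  have "curve j = 0" using curve_JJ[OF d d] jg JJ_2_eq[OF d] by simp
  moreover have "curve f = 0" using f curve_JJ[OF d k] by (simp add: graded_piece_def)
  ultimately have "curve g = 0" using jg by (simp add: curve_add)
  moreover define c where "c v = (\<Prod>j<v. d * t - j)" for v
  \<comment> \<open>A left inverse of \<open>curve\<close> on that span: v is read off the exponent
    of the variable 0, and the coefficient sum \<open>c v\<close> is divided out.\<close>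
  define h where "h = lin_ext (\<lambda>m. const_poly (1 / of_nat (c (Poly_Mapping.lookup m 0))) * e (Poly_Mapping.lookup m 0))"
  have "h (curve g) = g"
    using jg(3)
  proof (rule apoly.span_induct)
    show "apoly.subspace {g. h (curve g) = g}"
      by (rule apoly.subspaceI) (auto simp: h_def curve_zero curve_add curve_scale lin_ext_add lin_ext_scale)
    fix g assume "g \<in> range e"
    then obtain v where g: "g = e v" by blast
    have "h (curve (e v)) = const_poly (of_nat (c v)) * (const_poly (1 / of_nat (c v)) * e v)"
      unfolding curve_comb[OF e, folded c_def] h_def lin_ext_scale by (simp add: curve_var_def)
    also have "\<dots> = const_poly (of_nat (c v) * (1 / of_nat (c v))) * e v"
      by (simp only: const_poly_mult mult.assoc)
    also have "\<dots> = e v"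
    proof (cases "v \<le> d * t")
      case True
      then have "c v > 0" by (auto simp: c_def intro!: prod_pos)
      then show ?thesis by simp
    next
      \<comment> \<open>Here \<open>c v\<close> is 0, but \<open>e v\<close> is 0 as well because
        its weight exceeds the maximum d * t.\<close>
      case False
      then show ?thesis using comb_degenerate[OF e] by simp
    qed
    finally show "h (curve g) = g" by (simp add: g)
  qed
  moreover have "h 0 = 0" by (simp add: h_def)
  ultimately have "g = 0" by auto
  then show ?thesis using jg JJ_2_eq[OF d] by simp
qed

section \<open>The ideal of the curve and the dimension count\<close>

text \<open>The inner alternating sums of a transvectant coefficient are iterated differences of the
  products \<open>avar i * avar (w - i)\<close>. Subtracting the successor avoids an extra factor
  \<open>(- 1) ^ r\<close>.\<close>

fun fdiff :: "(nat \<Rightarrow> apoly) \<Rightarrow> nat \<Rightarrow> nat \<Rightarrow> apoly" where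
  "fdiff y 0 k = y k"
| "fdiff y (Suc r) k = fdiff y r k - fdiff y r (Suc k)"

lemma fdiff_eq_sum: "fdiff y r k = (\<Sum>i\<le>r. (- 1) ^ i * of_nat (r choose i) * y (k + i))"
proof (induction r arbitrary: k)
  case (Suc r)
  have "(\<Sum>i\<le>Suc r. (- 1) ^ i * of_nat (Suc r choose i) * y (k + i))
      = y k + (\<Sum>i\<le>r. (- 1) ^ Suc i * of_nat (r choose Suc i) * y (k + Suc i)) + (\<Sum>i\<le>r. (- 1) ^ Suc i * of_nat (r choose i) * y (k + Suc i))"
    unfolding sum.atMost_Suc_shift by (simp add: sum.distrib[symmetric] algebra_simps)
  also have "y k + (\<Sum>i\<le>r. (- 1) ^ Suc i * of_nat (r choose Suc i) * y (k + Suc i)) = (\<Sum>i\<le>Suc r. (- 1) ^ i * of_nat (r choose i) * y (k + i))"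
    unfolding sum.atMost_Suc_shift by simp
  also have "\<dots> = fdiff y r k" unfolding Suc by simp
  also have "(\<Sum>i\<le>r. (- 1) ^ Suc i * of_nat (r choose i) * y (k + Suc i)) = - fdiff y r (Suc k)"
    unfolding Suc by (simp add: sum_negf[symmetric])
  finally show ?case by simp
qed simp

text \<open>Reflecting a symmetric sequence reverses the order of each difference, so every one of
  the r steps costs a sign.\<close>

lemma fdiff_reflect:
  assumes sym: "\<And>i. i \<le> w \<Longrightarrow> y (w - i) = y i"
  shows "k + r \<le> w \<Longrightarrow> fdiff y r (w - r - k) = (- 1) ^ r * fdiff y r k"
proof (induction r arbitrary: k)
  case 0
  then show ?case using sym by simp
next
  case (Suc r)
  have "fdiff y (Suc r) (w - Suc r - k) = fdiff y r (w - r - Suc k) - fdiff y r (w - r - k)"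
    using Suc.prems by (simp add: Suc_diff_Suc)
  also have "\<dots> = (- 1) ^ r * fdiff y r (Suc k) - (- 1) ^ r * fdiff y r k"
    using Suc.IH[of "Suc k"] Suc.IH[of k] Suc.prems by simp
  finally show ?case by (simp add: right_diff_distrib)
qed

lemma transv_coeff_fdiff:
  "r \<le> w \<Longrightarrow> transv_coeff d r (w - r) = (\<Sum>k\<le>w - r. of_nat ((d - r choose k) * (d - r choose (w - r - k))) *
     fdiff (\<lambda>i. avar i * avar (w - i)) r k)"
proof -
  assume "r \<le> w"
  have "transv_coeff d r (w - r) = (\<Sum>i\<le>r. \<Sum>k\<le>w - r. (- 1) ^ i * of_nat (r choose i) *
     (of_nat ((d - r choose k) * (d - r choose (w - r - k))) * (avar (k + i) * avar (w - r - k + (r - i)))))"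
    by (simp only: transv_coeff_def sum_distrib_left)
  also have "\<dots> = (\<Sum>k\<le>w - r. \<Sum>i\<le>r. (- 1) ^ i * of_nat (r choose i) *
     (of_nat ((d - r choose k) * (d - r choose (w - r - k))) * (avar (k + i) * avar (w - r - k + (r - i)))))"
    by (rule sum.swap)
  also have "\<dots> = (\<Sum>k\<le>w - r. of_nat ((d - r choose k) * (d - r choose (w - r - k))) *
     fdiff (\<lambda>i. avar i * avar (w - i)) r k)"
    unfolding fdiff_eq_sum sum_distrib_left
  proof (intro sum.cong refl)
    fix k i assume "k \<in> {..w - r}" "i \<in> {..r}"
    then have "w - r - k + (r - i) = w - (k + i)" using \<open>r \<le> w\<close> by auto
    then show "(- 1) ^ i * of_nat (r choose i) * (of_nat ((d - r choose k) * (d - r choose (w - r - k))) * (avar (k + i) * avar (w - r - k + (r - i))))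
      = of_nat ((d - r choose k) * (d - r choose (w - r - k))) * ((- 1) ^ i * of_nat (r choose i) * (avar (k + i) * avar (w - (k + i))))"
      by (simp only: ac_simps)
  qed
  finally show ?thesis .
qed

text \<open>Descending induction on \<open>r\<close>: modulo the ideal the \<open>r\<close>-th differences are all equal, and for even
  \<open>r\<close> a positive combination of them is a generator, while for odd \<open>r\<close> they are antisymmetric.\<close>

lemma fdiff_in_JJ:
  assumes d: "d \<ge> 2" and w: "w \<le> 2 * d"
  defines "I \<equiv> JJ d (2 * half_deg d)" and "y \<equiv> \<lambda>i. avar i * avar (w - i)"
  shows "r \<ge> 1 \<Longrightarrow> w - d \<le> k \<Longrightarrow> k + r \<le> min w d \<Longrightarrow> fdiff y r k \<in> I"
proof (induction "d - r" arbitrary: r k rule: less_induct)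
  case less
  \<comment> \<open>For i between lo and hi both i and w - i lie in the range 0 to d, so that
    \<open>y i\<close> involves only variables of the ring.\<close>
  define lo where "lo = w - d"
  define hi where "hi = min w d"
  have lohi: "lo + hi = w" "lo \<le> k" "k + r \<le> hi" "hi \<le> d" "hi \<le> w" "lo \<le> d"
    using less.prems w by (auto simp: lo_def hi_def)
  have hd: "2 * half_deg d \<le> d" by (simp add: half_deg_def)
  have I: "apoly.subspace I"
    using coord_ring_idealD(1)[OF JJ_ideal[OF d hd]] by (simp add: I_def)
  have step: "fdiff y r j - fdiff y r (Suc j) \<in> I" if "lo \<le> j" "Suc j + r \<le> hi" for j
  proof -
    have "d - Suc r < d - r" using that lohi by linarith
    from less.hyps[OF this, of j] that show ?thesis by (simp add: lo_def hi_def)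
  qed
  have eq: "fdiff y r lo - fdiff y r j \<in> I" if "lo \<le> j" "j + r \<le> hi" for j
    using that
  proof (induction j rule: dec_induct)
    case base
    then show ?case using apoly.subspace_0[OF I] by simp
  next
    case (step n)
    have "fdiff y r lo - fdiff y r n + (fdiff y r n - fdiff y r (Suc n)) \<in> I"
      using step \<open>\<And>j. lo \<le> j \<Longrightarrow> Suc j + r \<le> hi \<Longrightarrow> fdiff y r j - fdiff y r (Suc j) \<in> I\<close>
      by (intro apoly.subspace_add[OF I]) auto
    then show ?case by simp
  qed
  have "fdiff y r lo \<in> I"
  proof (cases "even r")
    case True
    then obtain q where q: "r = 2 * q" by blast
    define C where "C j = (d - r choose j) * (d - r choose (w - r - j))" for j
    have "transv_coeff d r (w - r) \<in> I"
      unfolding I_def q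
      by (rule JJ_gen_mem[OF d hd]) (use q lohi less.prems in \<open>auto simp: half_deg_def\<close>)
    then have gen: "(\<Sum>j\<le>w - r. of_nat (C j) * fdiff y r j) \<in> I"
      using transv_coeff_fdiff[of r w d] lohi by (simp add: C_def y_def)
    have "(\<Sum>j\<le>w - r. of_nat (C j) * (fdiff y r lo - fdiff y r j)) \<in> I"
    proof (rule apoly.subspace_sum[OF I])
      fix j assume j: "j \<in> {..w - r}"
      show "of_nat (C j) * (fdiff y r lo - fdiff y r j) \<in> I"
      proof (cases "C j = 0")
        case False
        \<comment> \<open>Nonvanishing of the binomial coefficients confines j to the range in which
          \<open>eq\<close> compares the differences.\<close>
        then have "j \<le> d - r" "w - r - j \<le> d - r" by (auto simp: C_def not_less[symmetric] simp del: not_less)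
        then have "fdiff y r lo - fdiff y r j \<in> I"
          using j lohi by (intro eq) (auto simp: lo_def hi_def)
        from apoly.subspace_scale[OF I this, of "of_nat (C j)"] show ?thesis by simp
      qed (use apoly.subspace_0[OF I] in simp)
    qed
    from apoly.subspace_add[OF I this gen] have "(\<Sum>j\<le>w - r. of_nat (C j) * fdiff y r lo) \<in> I"
      by (simp add: sum.distrib[symmetric] right_diff_distrib)
    then have "of_nat (\<Sum>j\<le>w - r. C j) * fdiff y r lo \<in> I" by (simp add: sum_distrib_right)
    moreover have "lo \<le> d - r" "w - r - lo \<le> d - r" using lohi by linarith+
    then have "C lo > 0" by (simp add: C_def)
    then have "(\<Sum>j\<le>w - r. C j) > 0"
      using lohi by (intro sum_pos2[of _ lo]) auto
    ultimately show ?thesis using subspace_of_nat_cancel[OF I] by blast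
  next
    case False
    \<comment> \<open>The reflected index w - r - lo equals hi - r, the other end of the admissible
      range.\<close>
    have "fdiff y r (w - r - lo) = - fdiff y r lo"
      using fdiff_reflect[of w y lo r] False lohi by (simp add: y_def mult.commute)
    moreover have "fdiff y r lo - fdiff y r (w - r - lo) \<in> I"
      by (rule eq) (use lohi in auto)
    ultimately have "of_nat 2 * fdiff y r lo \<in> I" by simp
    then show ?thesis by (rule subspace_of_nat_cancel[OF I]) simp
  qed
  from apoly.subspace_diff[OF I this eq[of k]] lohi show ?case by simp
qed

text \<open>Telescoping the first differences yields every 2 x 2 minor, so the ideal of the curve is
  contained in the last ideal of the chain.\<close>

lemma var_prod_equiv:
  assumes d: "d \<ge> 2" and ij: "i \<le> d" "j \<le> d" "k \<le> d" "l \<le> d" "i + j = k + l"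
  shows "avar i * avar j - avar k * avar l \<in> JJ d (2 * half_deg d)" (is "_ \<in> ?I")
proof -
  define w where "w = i + j"
  define y where "y = (\<lambda>i. avar i * avar (w - i))"
  have hd: "2 * half_deg d \<le> d" by (simp add: half_deg_def)
  have I: "apoly.subspace ?I" by (rule coord_ring_idealD(1)[OF JJ_ideal[OF d hd]])
  have step: "y n - y (Suc n) \<in> ?I" if "w - d \<le> n" "Suc n \<le> min w d" for n
    using fdiff_in_JJ[OF d, of w 1 n] that ij by (simp add: w_def y_def)
  have *: "y (w - d) - y n \<in> ?I" if "w - d \<le> n" "n \<le> min w d" for n
    using that
  proof (induction n rule: dec_induct)
    case base
    then show ?case using apoly.subspace_0[OF I] by simp
  next
    case (step n)
    have "y (w - d) - y n + (y n - y (Suc n)) \<in> ?I"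
      by (rule apoly.subspace_add[OF I step.IH]) (use step \<open>\<And>n. w - d \<le> n \<Longrightarrow> Suc n \<le> min w d \<Longrightarrow> y n - y (Suc n) \<in> ?I\<close> in auto)
    then show ?case by simp
  qed
  have "y (w - d) - y k - (y (w - d) - y i) \<in> ?I"
    by (intro apoly.subspace_diff[OF I] *) (use ij in \<open>auto simp: w_def\<close>)
  moreover have "w - i = j" "w - k = l" using ij by (auto simp: w_def)
  ultimately show ?thesis by (simp add: y_def)
qed

section \<open>Canonical monomials modulo the ideal of the curve\<close>

fun canon :: "nat \<Rightarrow> nat \<Rightarrow> nat \<Rightarrow> nat list" where
  "canon d 0 v = []"
| "canon d (Suc r) v = min v d # canon d r (v - min v d)"

lemma canon_props: "v \<le> d * r \<Longrightarrow> set (canon d r v) \<subseteq> {..d} \<and> length (canon d r v) = r \<and> sum_list (canon d r v) = v"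
proof (induction r arbitrary: v)
  case (Suc r)
  then have "v - min v d \<le> d * r" by (auto simp: min_def)
  from Suc.IH[OF this] show ?case by auto
qed simp

text \<open>Exchanging two indices for two others with the same sum is allowed by
  \<open>var_prod_equiv\<close>, and such exchanges lead to the greedy list with as many entries d
  as possible. One representative per weight therefore suffices.\<close>

lemma mon_canon_equiv:
  assumes d: "d \<ge> 2"
  shows "set xs \<subseteq> {..d} \<Longrightarrow> mon avar xs - mon avar (canon d (length xs) (sum_list xs)) \<in> JJ d (2 * half_deg d)" (is "_ \<Longrightarrow> _ \<in> ?I")
proof -
  have hd: "2 * half_deg d \<le> d" by (simp add: half_deg_def)
  note I = coord_ring_idealD[OF JJ_ideal[OF d hd]]
  have insert: "mon avar (x # canon d r u) - mon avar (canon d (Suc r) (x + u)) \<in> ?I"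
    if "x \<le> d" "u \<le> d * r" for x u r
    using that
  proof (induction r arbitrary: x u)
    case 0
    then show ?case using apoly.subspace_0[OF I(1)] by simp
  next
    case (Suc r)
    define s where "s = min u d"
    \<comment> \<open>The pair x, s is exchanged for p, q: p is the head of the new greedy list, and
      the rest q is inserted into the shorter list by induction.\<close>
    define p where "p = min (x + u) d"
    define q where "q = x + s - p"
    have pq: "p \<le> d" "q \<le> d" "x + s = p + q" "s \<le> d" "u - s \<le> d * r" "q + (u - s) = x + u - p"
      using Suc.prems by (auto simp: s_def p_def q_def min_def)
    define c where "c = mon avar (canon d r (u - s))"
    define N where "N = mon avar (canon d (Suc r) (x + u - p))"
    have c: "c \<in> carrier (coord_ring d)"
      unfolding c_def using canon_props[OF pq(5)] by (intro coord_ring_mon) blast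
    have "c * (avar x * avar s - avar p * avar q) + avar p * (mon avar (q # canon d r (u - s)) - N) \<in> ?I"
    proof (rule apoly.subspace_add[OF I(1)])
      show "c * (avar x * avar s - avar p * avar q) \<in> ?I"
        by (rule I(3)[OF var_prod_equiv[OF d _ _ _ _ pq(3)] c]) (use pq Suc.prems in auto)
      show "avar p * (mon avar (q # canon d r (u - s)) - N) \<in> ?I"
        using Suc.IH[OF pq(2,5)] pq unfolding N_def by (intro I(3) coord_ring_avar) (auto simp del: canon.simps)
    qed
    moreover have "mon avar (x # canon d (Suc r) u) = avar x * (avar s * c)"
      "mon avar (canon d (Suc (Suc r)) (x + u)) = avar p * N"
      by (simp_all only: canon.simps mon_simps s_def p_def c_def N_def)
    moreover have "c * (avar x * avar s - avar p * avar q) + avar p * (mon avar (q # canon d r (u - s)) - N)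
      = avar x * (avar s * c) - avar p * N"
      by (simp add: c_def algebra_simps)
    ultimately show ?case by (simp only:)
  qed
  show "set xs \<subseteq> {..d} \<Longrightarrow> mon avar xs - mon avar (canon d (length xs) (sum_list xs)) \<in> ?I"
  proof (induction xs)
    case Nil
    then show ?case using apoly.subspace_0[OF I(1)] by simp
  next
    case (Cons x xs)
    have "avar x * (mon avar xs - mon avar (canon d (length xs) (sum_list xs))) \<in> ?I"
      using Cons by (intro I(3) coord_ring_avar) auto
    moreover have "mon avar (x # canon d (length xs) (sum_list xs)) - mon avar (canon d (Suc (length xs)) (x + sum_list xs)) \<in> ?I"
      using Cons.prems sum_list_le by (intro insert) auto
    ultimately have "avar x * (mon avar xs - mon avar (canon d (length xs) (sum_list xs)))
      + (mon avar (x # canon d (length xs) (sum_list xs)) - mon avar (canon d (Suc (length xs)) (x + sum_list xs))) \<in> ?I"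
      by (rule apoly.subspace_add[OF I(1)])
    then show ?case by (simp add: right_diff_distrib del: canon.simps)
  qed
qed

section \<open>Counting dimensions degree by degree\<close>

definition homog_proj :: "nat \<Rightarrow> apoly \<Rightarrow> apoly" where
  "homog_proj t = lin_ext (\<lambda>m. if mono_degree m = t then mterm m else 0)"

lemma homog_proj_homog:
  assumes "\<And>m. m \<in> Poly_Mapping.keys f \<Longrightarrow> mono_degree m = s"
  shows "homog_proj t f = (if s = t then f else 0)"
proof -
  have "homog_proj t f = (\<Sum>m\<in>Poly_Mapping.keys f. const_poly (Poly_Mapping.lookup f m) * (if s = t then mterm m else 0))"
    unfolding homog_proj_def lin_ext_def by (intro sum.cong refl) (simp add: assms)
  also have "\<dots> = (if s = t then f else 0)"
    using apoly_expand[of "Poly_Mapping.keys f" f] by auto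
  finally show ?thesis .
qed

lemma homog_subspace: "apoly.subspace {f :: apoly. \<forall>m\<in>Poly_Mapping.keys f. mono_degree m = t}"
proof (rule apoly.subspaceI)
  fix f g :: apoly assume "f \<in> {f. \<forall>m\<in>Poly_Mapping.keys f. mono_degree m = t}" "g \<in> {f. \<forall>m\<in>Poly_Mapping.keys f. mono_degree m = t}"
  then show "f + g \<in> {f. \<forall>m\<in>Poly_Mapping.keys f. mono_degree m = t}" using keys_add[of f g] by blast
next
  fix c and f :: apoly assume "f \<in> {f. \<forall>m\<in>Poly_Mapping.keys f. mono_degree m = t}"
  then show "const_poly c * f \<in> {f. \<forall>m\<in>Poly_Mapping.keys f. mono_degree m = t}"
    by (simp add: in_keys_iff lookup_const_mult)
qed simp

lemma homog_mon: "m \<in> Poly_Mapping.keys (mon avar xs) \<Longrightarrow> mono_degree m = length xs"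
  by (simp add: mon_avar mterm_def mono_degree_of_list flip: One_nat_def)

lemma homog_hess_gen_mult: "m \<in> Poly_Mapping.keys (mon avar xs * hess_gen avar d n) \<Longrightarrow> mono_degree m = length xs + 2"
proof -
  let ?H = "{f. \<forall>m\<in>Poly_Mapping.keys f. mono_degree m = length xs + 2}"
  have H: "mon avar (xs @ [i, j]) \<in> ?H" for i j using homog_mon[of _ "xs @ [i, j]"] by auto
  have "mon avar xs * hess_gen avar d n = (\<Sum>k\<le>n. const_poly (of_nat ((d - 2 choose k) * (d - 2 choose (n - k)))) *
     (mon avar (xs @ [k, n - k + 2]) - mon avar (xs @ [k + 1, n - k + 1])))"
    unfolding hess_gen_def sum_distrib_left mon_append mon_simps const_poly_of_nat mult_1_right right_diff_distrib
    by (intro sum.cong refl) (simp only: ac_simps)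
  also have "\<dots> \<in> ?H"
    by (intro apoly.subspace_sum[OF homog_subspace] apoly.subspace_scale[OF homog_subspace] apoly.subspace_diff[OF homog_subspace] H)
  finally show "m \<in> Poly_Mapping.keys (mon avar xs * hess_gen avar d n) \<Longrightarrow> mono_degree m = length xs + 2" by blast
qed

definition monomials :: "nat \<Rightarrow> nat \<Rightarrow> mono set" where
  "monomials d t = {m. Poly_Mapping.keys m \<subseteq> {..d} \<and> mono_degree m = t}"

text \<open>Stars and bars for exponent vectors of length d + 1.\<close>

lemma card_monomials: "card (monomials d t) = (d + t) choose d" and finite_monomials: "finite (monomials d t)"
proof -
  let ?L = "{l :: nat list. length l = Suc d \<and> sum_list l = t}"
  let ?f = "\<lambda>m. map (Poly_Mapping.lookup m) [0..<Suc d]"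
  have sum: "sum_list (?f m) = mono_degree m" if "Poly_Mapping.keys m \<subseteq> {..d}" for m :: mono
  proof -
    have "set [0..<Suc d] = {..d}" by auto
    with mono_degree_superset[OF _ that] show ?thesis
      by (simp only: interv_sum_list_conv_sum_set_nat finite_atMost)
  qed
  have "bij_betw ?f (monomials d t) ?L"
    unfolding bij_betw_def
  proof
    show "inj_on ?f (monomials d t)"
    proof (rule inj_onI)
      fix m m' assume m: "m \<in> monomials d t" "m' \<in> monomials d t" and eq: "?f m = ?f m'"
      show "m = m'"
      proof (rule poly_mapping_eqI)
        fix i
        show "Poly_Mapping.lookup m i = Poly_Mapping.lookup m' i"
        proof (cases "i \<le> d")
          case True
          then show ?thesis using eq by (auto simp: map_eq_conv simp del: upt_Suc)
        next
          case False
          then have "i \<notin> Poly_Mapping.keys m" "i \<notin> Poly_Mapping.keys m'" using m by (auto simp: monomials_def)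
          then show ?thesis by (simp add: in_keys_iff)
        qed
      qed
    qed
    show "?f ` monomials d t = ?L"
    proof
      show "?f ` monomials d t \<subseteq> ?L" using sum by (auto simp: monomials_def simp del: upt_Suc)
      show "?L \<subseteq> ?f ` monomials d t"
      proof
        fix l assume l: "l \<in> ?L"
        define m where "m = Poly_Mapping.nth l"
        have lk: "Poly_Mapping.lookup m i = nth_default 0 l i" for i by (simp add: m_def)
        have keys: "Poly_Mapping.keys m \<subseteq> {..d}"
          using l by (auto simp: in_keys_iff lk nth_default_def split: if_splits)
        have f: "?f m = l" using l by (intro nth_equalityI) (auto simp: lk nth_default_def simp del: upt_Suc)
        then have "mono_degree m = t" using sum[OF keys] l by simp
        then show "l \<in> ?f ` monomials d t" using f keys by (intro image_eqI[of _ _ m]) (auto simp: monomials_def simp del: upt_Suc)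
      qed
    qed
  qed
  then have "card (monomials d t) = card ?L" by (rule bij_betw_same_card)
  also have "\<dots> = (t + Suc d - 1) choose t" by (rule card_length_sum_list)
  also have "\<dots> = (d + t) choose d"
  proof -
    have "t + Suc d - 1 = d + t" "d + t - d = t" by simp_all
    with binomial_symmetric[of d "d + t"] show ?thesis by (simp only: le_add1)
  qed
  finally show c: "card (monomials d t) = (d + t) choose d" .
  \<comment> \<open>Infinite sets have cardinality 0, so positivity of the binomial coefficient
    gives finiteness.\<close>
  then show "finite (monomials d t)" by (intro card_ge_0_finite) simp
qed

lemma mterm_inj: "inj mterm"
proof (rule injI)
  fix m m' assume "mterm m = mterm m'"
  moreover have "Poly_Mapping.lookup (mterm m) m = 1" by (simp add: mterm_def)
  ultimately have "Poly_Mapping.lookup (mterm m') m = 1" by simp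
  then show "m = m'" by (simp add: mterm_def lookup_single when_def split: if_splits)
qed

lemma mterm_independent: "apoly.independent (mterm ` A)"
  unfolding apoly.dependent_def
proof clarify
  fix m assume *: "mterm m \<in> apoly.span (mterm ` A - {mterm m})"
  have "apoly.subspace {f. Poly_Mapping.lookup f m = 0}"
    by (rule apoly.subspaceI) (auto simp: lookup_add lookup_const_mult)
  then have "apoly.span (mterm ` A - {mterm m}) \<subseteq> {f. Poly_Mapping.lookup f m = 0}"
    by (intro apoly.span_minimal) (auto simp: mterm_def lookup_single when_def)
  then show False using * by (auto simp: mterm_def)
qed

text \<open>\<open>G\<close> contains the multiples of the 2 * d - 3 Hessian coefficients by
  monomials of degree t - 2, and \<open>K\<close> one monomial for each of the d * t + 1 weights. If
  the first and last ideals agree in degree t, the two sets together span that degree of the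
  ring.\<close>

lemma dimension_count:
  assumes d: "d \<ge> 2" and eq: "graded_piece (JJ d (2 * half_deg d)) t = graded_piece (JJ d 2) t"
    and t: "t \<ge> 2"
  shows "(d + t) choose d \<le> (2 * d - 3) * ((d + t - 2) choose d) + d * t + 1"
proof -
  define G where "G = (\<lambda>(m, n). mterm m * hess_gen avar d n) ` (monomials d (t - 2) \<times> {..2 * (d - 2)})"
  define K where "K = (\<lambda>v. mon avar (canon d t v)) ` {..d * t}"
  have fin: "finite (G \<union> K)" using finite_monomials by (simp add: G_def K_def)
  have hd: "2 * half_deg d \<le> d" by (simp add: half_deg_def)
  \<comment> \<open>An element of degree t is a priori a combination of generators of all degrees;
    projection keeps only those in \<open>G\<close>.\<close>
  have proj: "homog_proj t f \<in> apoly.span G" if "f \<in> hess_span d" for f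
  proof -
    have "hess_span d \<subseteq> {f. homog_proj t f \<in> apoly.span G}"
      unfolding hess_span_def[OF d]
    proof (rule apoly.span_minimal)
      show "apoly.subspace {f. homog_proj t f \<in> apoly.span G}"
        unfolding homog_proj_def by (rule subspace_lin_ext_vimage) simp
      show "{mon avar xs * hess_gen avar d n | xs n. set xs \<subseteq> {..d} \<and> n \<le> 2 * (d - 2)} \<subseteq> {f. homog_proj t f \<in> apoly.span G}"
      proof clarify
        fix xs n assume xs: "set xs \<subseteq> {..d}" "n \<le> 2 * (d - 2)"
        have p: "homog_proj t (mon avar xs * hess_gen avar d n) = (if length xs + 2 = t then mon avar xs * hess_gen avar d n else 0)"
          by (rule homog_proj_homog) (rule homog_hess_gen_mult)
        show "homog_proj t (mon avar xs * hess_gen avar d n) \<in> apoly.span G"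
        proof (cases "length xs + 2 = t")
          case True
          let ?m = "\<Sum>i\<leftarrow>xs. Poly_Mapping.single i 1 :: mono"
          have "Poly_Mapping.keys ?m \<subseteq> set xs"
            by (induction xs) (auto dest!: subsetD[OF keys_add])
          then have "?m \<in> monomials d (t - 2)" using xs True by (auto simp: monomials_def mono_degree_of_list[unfolded One_nat_def])
          then have "mon avar xs * hess_gen avar d n \<in> G"
            unfolding G_def mon_avar using xs(2) by (intro image_eqI[of _ _ "(?m, n)"]) auto
          then show ?thesis unfolding p using True apoly.span_base by simp
        next
          case False
          then show ?thesis unfolding p using apoly.span_zero by simp
        qed
      qed
    qed
    with that show ?thesis by blast
  qed
  have "mterm ` monomials d t \<subseteq> apoly.span (G \<union> K)"
  proof clarify
    fix m assume m: "m \<in> monomials d t"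
    then have m': "Poly_Mapping.keys m \<subseteq> {..d}" "mono_degree m = t" by (auto simp: monomials_def)
    obtain xs where xs: "mterm m = mon avar xs" "set xs \<subseteq> {..d}" "length xs = t"
      by (rule mterm_eq_mon[OF m'(1)]) (use m'(2) in blast)
    define v where "v = sum_list xs"
    have v: "v \<le> d * t" using sum_list_le[OF xs(2)] xs by (simp add: v_def)
    define f where "f = mon avar xs - mon avar (canon d t v)"
    have "f \<in> JJ d (2 * half_deg d)" using mon_canon_equiv[OF d xs(2)] xs by (simp add: f_def v_def)
    moreover have hom: "\<forall>m\<in>Poly_Mapping.keys f. mono_degree m = t"
      using apoly.subspace_diff[OF homog_subspace, of "mon avar xs" t "mon avar (canon d t v)"] homog_mon[of _ xs] homog_mon[of _ "canon d t v"] canon_props[OF v] xs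
      by (simp add: f_def)
    ultimately have "f \<in> graded_piece (JJ d 2) t" unfolding eq[symmetric] by (simp add: graded_piece_def)
    then have "f \<in> hess_span d" using JJ_2_eq[OF d] by (simp add: graded_piece_def)
    from proj[OF this] have "f \<in> apoly.span G" using homog_proj_homog[of f t t] hom by simp
    then have "f \<in> apoly.span (G \<union> K)" using apoly.span_mono[of G "G \<union> K"] by blast
    moreover have "mon avar (canon d t v) \<in> apoly.span (G \<union> K)"
      by (rule apoly.span_base) (use v in \<open>auto simp: K_def\<close>)
    ultimately have "f + mon avar (canon d t v) \<in> apoly.span (G \<union> K)" by (rule apoly.span_add)
    then show "mterm m \<in> apoly.span (G \<union> K)" by (simp add: f_def xs)
  qed
  from apoly.independent_span_bound[OF fin mterm_independent this]
  have "card (mterm ` monomials d t) \<le> card (G \<union> K)" by blast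
  also have "card (mterm ` monomials d t) = (d + t) choose d"
    by (simp add: card_image inj_on_subset[OF mterm_inj] card_monomials)
  also have "card (G \<union> K) \<le> card G + card K" by (rule card_Un_le)
  also have "card G \<le> card (monomials d (t - 2) \<times> {..2 * (d - 2)})"
    unfolding G_def by (rule card_image_le) (simp add: finite_monomials)
  also have "\<dots> = (2 * d - 3) * ((d + t - 2) choose d)"
  proof -
    have "Suc (2 * (d - 2)) = 2 * d - 3" "d + (t - 2) = d + t - 2" using d t by auto
    then show ?thesis by (simp only: card_cartesian_product card_monomials card_atMost mult.commute)
  qed
  also have "card K \<le> d * t + 1"
    unfolding K_def using card_image_le[of "{..d * t}" "\<lambda>v. mon avar (canon d t v)"] by simp
  finally show ?thesis by simp
qed

section \<open>From the dimension count to the numerical bound\<close>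

lemma dimension_count_bound:
  assumes d: "d \<ge> 4" and t: "t \<ge> 3"
    and count: "(d + t) choose d \<le> (2 * d - 3) * ((d + t - 2) choose d) + d * t + 1"
  shows "1 / (real d - 2) * sqrt ((real d - 1) * ((real d)\<^sup>2 - 2) / 2) \<le> real t"
proof (rule ccontr)
  assume neg: "\<not> ?thesis"
  define D T where "D = real d" and "T = real t"
  define N M where "N = real ((d + t) choose d)" and "M = real ((d + t - 2) choose d)"
  have DT: "D \<ge> 4" "T \<ge> 3" using d t by (simp_all add: D_def T_def)
  have "(D - 2) * T < sqrt ((D - 1) * (D\<^sup>2 - 2) / 2)"
    using neg DT by (simp add: D_def T_def field_simps)
  then have "((D - 2) * T)\<^sup>2 < (sqrt ((D - 1) * (D\<^sup>2 - 2) / 2))\<^sup>2"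
    using DT by (intro power_strict_mono) auto
  also have "\<dots> = (D - 1) * (D\<^sup>2 - 2) / 2"
  proof (rule real_sqrt_pow2)
    have "D\<^sup>2 \<ge> 4\<^sup>2" using DT by (intro power_mono) auto
    then show "0 \<le> (D - 1) * (D\<^sup>2 - 2) / 2" using DT by simp
  qed
  finally have sq: "2 * ((D - 2) * T)\<^sup>2 < (D - 1) * (D\<^sup>2 - 2)" by simp
  \<comment> \<open>Two absorption identities, with \<open>X\<close> in between, relate N to
    M.\<close>
  define X where "X = (d + t - 1) choose d"
  have t1: "real (t - 1) = T - 1" "real (d + t - 1) = D + T - 1"
    using t by (simp_all add: T_def D_def of_nat_diff)
  have "t * ((d + t) choose d) = (d + t) * X"
    using binomial_absorb_comp[of "d + t" d] by (simp add: X_def)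
  then have "real (t * ((d + t) choose d)) = real ((d + t) * X)" by (rule arg_cong)
  then have 1: "T * N = (D + T) * real X" by (simp add: T_def D_def N_def)
  have "(t - 1) * X = (d + t - 1) * ((d + t - 2) choose d)"
    using binomial_absorb_comp[of "d + t - 1" d] t by (simp add: X_def numeral_2_eq_2)
  then have "real ((t - 1) * X) = real ((d + t - 1) * ((d + t - 2) choose d))" by (rule arg_cong)
  then have 2: "(T - 1) * real X = (D + T - 1) * M" by (simp only: of_nat_mult t1 M_def)
  have "T * (T - 1) * N = (T - 1) * (T * N)" by (simp only: ac_simps)
  also have "\<dots> = (D + T) * ((T - 1) * real X)" unfolding 1 by (simp only: ac_simps)
  finally have NM: "T * (T - 1) * N = (D + T) * (D + T - 1) * M" unfolding 2 by (simp only: ac_simps)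
  have "N \<le> (2 * D - 3) * M + D * T + 1"
  proof -
    have "real ((d + t) choose d) \<le> real ((2 * d - 3) * ((d + t - 2) choose d) + d * t + 1)"
      using count by (simp only: of_nat_le_iff)
    then show ?thesis using d by (simp add: N_def M_def D_def T_def of_nat_diff)
  qed
  then have "T * (T - 1) * N \<le> T * (T - 1) * ((2 * D - 3) * M + D * T + 1)"
    using DT by (intro mult_left_mono) auto
  then have Q: "M * ((D + T) * (D + T - 1) - (2 * D - 3) * T * (T - 1)) \<le> (D * T + 1) * (T * (T - 1))"
    unfolding NM by (simp add: algebra_simps)
  \<comment> \<open>The count bounds M * Q from above. The negated claim limits the square of T,
    which is the only negative contribution to (D - 2) * Q, and so forces Q to be large.\<close>
  define Q where "Q = (D + T) * (D + T - 1) - (2 * D - 3) * T * (T - 1)"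
  have 3: "(D - 2) * Q = (D - 2) * (D - 1) * (D + 4 * T) - 2 * ((D - 2) * T)\<^sup>2"
    by (simp add: Q_def power2_eq_square algebra_simps)
  have "(D - 2) * (D - 1) * (D + 4 * T) - (D - 1) * (D\<^sup>2 - 2) < (D - 2) * Q" unfolding 3 using sq by simp
  \<comment> \<open>The remainder is grouped so that it is visibly nonnegative for D >= 4 and T >=
    3.\<close>
  moreover have 4: "(D - 2) * (D - 1) * (D + 4 * T) - (D - 1) * (D\<^sup>2 - 2)
      = (D - 2) * (2 * (D * T + 1)) + (2 * (D - 2)\<^sup>2 * (T - 3) + 4 * (D - 4) * (D - 2) + 2 * (D - 2) - 2)"
    by (simp add: power2_eq_square algebra_simps)
  moreover have "(D - 2) * (2 * (D * T + 1)) \<le> (D - 2) * (D - 1) * (D + 4 * T) - (D - 1) * (D\<^sup>2 - 2)"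
  proof -
    have "2 * (D - 2)\<^sup>2 * (T - 3) \<ge> 0" "4 * (D - 4) * (D - 2) \<ge> 0" "2 * (D - 2) - 2 \<ge> 0"
      using DT by simp_all
    then have "2 * (D - 2)\<^sup>2 * (T - 3) + 4 * (D - 4) * (D - 2) + (2 * (D - 2) - 2) \<ge> 0"
      by (intro add_nonneg_nonneg)
    then show ?thesis unfolding 4 by (simp only: le_add_same_cancel1 add_diff_eq)
  qed
  ultimately have "(D - 2) * (2 * (D * T + 1)) < (D - 2) * Q" by linarith
  then have Q_gt: "2 * (D * T + 1) < Q" using mult_less_cancel_left_pos[of "D - 2"] DT by simp
  \<comment> \<open>A crude bound suffices: M = (d + t - 2) choose (t - 2) is at least t choose (t -
    2).\<close>
  have M_ge: "T * (T - 1) / 2 \<le> M"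
  proof -
    have "(d + t - 2) choose d = (d + t - 2) choose (t - 2)"
      using binomial_symmetric[of d "d + t - 2"] t by simp
    moreover have "t choose (t - 2) = t choose 2"
      using binomial_symmetric[of 2 t] t by simp
    moreover have "t choose (t - 2) \<le> (d + t - 2) choose (t - 2)"
      using d by (intro binomial_right_mono) simp
    moreover have "real (t choose 2) = T * (T - 1) / 2"
      using t by (simp add: T_def choose_two real_of_nat_div of_nat_diff)
    ultimately have "real (t choose 2) \<le> M" unfolding M_def by simp
    then show ?thesis using \<open>real (t choose 2) = T * (T - 1) / 2\<close> by simp
  qed
  have pos: "T * (T - 1) / 2 > 0" "D * T + 1 > 0" using DT by (simp_all add: add_pos_pos)
  have "T * (T - 1) / 2 * (2 * (D * T + 1)) < T * (T - 1) / 2 * Q"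
    by (rule mult_strict_left_mono[OF Q_gt pos(1)])
  also have "\<dots> \<le> M * Q"
    by (rule mult_right_mono[OF M_ge])
      (rule order_trans[OF mult_nonneg_nonneg less_imp_le[OF Q_gt]], use pos(2) in simp_all)
  also have "\<dots> \<le> (D * T + 1) * (T * (T - 1))" using Q unfolding Q_def .
  also have "y * x = x / 2 * (2 * y)" for x y :: real by simp
  finally show False by simp
qed

section \<open>Both bounds for the saturation sequence\<close>

theorem theorem1p2:
  fixes d :: nat
  assumes "d \<ge> 4"
  shows "1 / (real d - 2) * sqrt ((real d - 1) * ((real d)\<^sup>2 - 2) / 2) \<le> real (max_alpha d)
       \<and> max_alpha d \<le> d + 2"
proof -
  define e where "e = half_deg d"
  define S where "S = {alpha_seq d q | q. 1 \<le> q \<and> q \<le> e - 1}"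
  have d: "d \<ge> 2" "2 * e \<le> d" "e \<ge> 2" using assms by (auto simp: e_def half_deg_def)
  have S: "finite S" "alpha_seq d 1 \<in> S" using d by (auto simp: S_def)
  have max: "max_alpha d = Max S" by (simp add: max_alpha_def S_def e_def)
  \<comment> \<open>By \<open>graded_JJ_subset\<close> and monotonicity, both ideals agree with
    \<open>JJ d 2\<close> in these degrees.\<close>
  have stable: "\<forall>t\<ge>d + 2. graded_piece (JJ d (2 * q)) t = graded_piece (JJ d (2 * q + 2)) t"
    if "1 \<le> q" "q \<le> e - 1" for q
  proof (intro allI impI)
    fix t assume t: "d + 2 \<le> t"
    have k: "2 * q + 2 \<le> d" using that d by auto
    show "graded_piece (JJ d (2 * q)) t = graded_piece (JJ d (2 * q + 2)) t"
      using graded_JJ_subset[OF d(1) t k] JJ_mono[OF d(1), of 2 "2 * q"] JJ_mono[OF d(1), of "2 * q" "2 * q + 2"] k that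
      by (auto simp: graded_piece_def)
  qed
  have upper: "max_alpha d \<le> d + 2"
    unfolding max
  proof (rule Max.boundedI[OF S(1)])
    fix m assume "m \<in> S"
    then obtain q where "1 \<le> q" "q \<le> e - 1" "m = alpha_seq d q" by (auto simp: S_def)
    then show "m \<le> d + 2" using stable[of q] unfolding alpha_seq_def by (auto intro: Least_le)
  qed (use S(2) in blast)
  have agree: "graded_piece (JJ d (2 * q)) t = graded_piece (JJ d (2 * q + 2)) t"
    if "1 \<le> q" "q \<le> e - 1" "max_alpha d \<le> t" for q t
  proof -
    have "alpha_seq d q \<in> S" using that unfolding S_def by blast
    from order_trans[OF Max_ge[OF S(1) this] that(3)[unfolded max]] have "alpha_seq d q \<le> t" .
    moreover have "\<forall>t\<ge>alpha_seq d q. graded_piece (JJ d (2 * q)) t = graded_piece (JJ d (2 * q + 2)) t"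
      \<comment> \<open>The least element is meaningful only because some m qualifies;
        \<open>stable\<close> supplies d + 2.\<close>
      unfolding alpha_seq_def by (rule LeastI) (rule stable[OF that(1,2)])
    ultimately show ?thesis by blast
  qed
  have eq: "graded_piece (JJ d (2 * half_deg d)) t = graded_piece (JJ d 2) t" if "max_alpha d \<le> t" for t
  proof -
    have "q \<le> e \<Longrightarrow> graded_piece (JJ d (2 * q)) t = graded_piece (JJ d 2) t" if "1 \<le> q" for q
      using that
    proof (induction q rule: dec_induct)
      case (step q)
      then show ?case using agree[of q t] \<open>max_alpha d \<le> t\<close> by simp
    qed simp
    from this[of e] d show ?thesis by (simp add: e_def)
  qed
  \<comment> \<open>The numerical bound needs t >= 3. Were the maximum at most 2, the count in
    degree 2 would give (d + 2) * (d + 1) / 2 <= 4 * d - 2, which fails for d >= 4.\<close>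
  have "max_alpha d \<ge> 3"
  proof (rule ccontr)
    assume "\<not> max_alpha d \<ge> 3"
    then have "(d + 2) choose d \<le> (2 * d - 3) * ((d + 2 - 2) choose d) + d * 2 + 1"
      by (intro dimension_count[OF d(1) eq]) auto
    moreover have "(d + 2) choose d = (d + 2) * (d + 1) div 2"
      using binomial_symmetric[of 2 "d + 2"] choose_two[of "d + 2"] by simp
    moreover have "8 * d \<le> (d + 2) * (d + 1) + 2"
    proof -
      have "4 * d \<le> d * d" using assms by (intro mult_right_mono) auto
      moreover obtain k where "d = 4 + k" using assms le_Suc_ex by blast
      ultimately show ?thesis by (simp add: algebra_simps)
    qed
    ultimately show False using assms by simp
  qed
  then show ?thesis
    using dimension_count_bound[OF assms _ dimension_count[OF d(1) eq]] upper by simp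
qed

end
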